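(* Let $\mathbf{L}$ be a normed space and $(L^\nu)_{\nu\in\Lambda}$ a family of finite-dimensional contractively complemented subspaces of $\mathbf{L}$, with associated functor $\odot$. For $\nu\in\Lambda$ let $\mathbf{F}^\nu(\star)$ be $(L^\nu)^*$ with the minimal $\mathbf{L}$-norm (the injective tensor norm on $\mathbf{L}\otimes(L^\nu)^*$). Then: (i) $\mathbf{F}(\star):=(\oplus_{\nu\in\Lambda}\mathbf{F}^\nu(\star))_1$ is a $\odot$-free $\mathbf{L}$-space with the base a singleton $\{\star\}$. (ii) For any set $M$, $\mathbf{F}(M):=(\oplus_{t\in M}\mathbf{F}(t))_1$, where each $\mathbf{F}(t)$ is a copy of $\mathbf{F}(\star)$, is a $\odot$-free $\mathbf{L}$-space with the base $M$.
   Context: All linear spaces are over a fixed scalar field ($\mathbb{R}$ or $\mathbb{C}$). Fix a normed space $\mathbf{L}$; $\mathcal{B}(\mathbf{L})$ is the algebra of bounded operators on $\mathbf{L}$; $\otimes$ is the algebraic tensor product. For a linear space $E$, $\mathbf{L}\otimes E$ is a left $\mathcal{B}(\mathbf{L})$-module via $a\cdot(\xi\otimes x)=a\xi\otimes x$. An $\mathbf{L}$-norm on $E$ is a norm on $\mathbf{L}\otimes E$ with $\|a\cdot u\|\le\|a\|\|u\|$ for all $a\in\mathcal{B}(\mathbf{L})$, $u\in\mathbf{L}\otimes E$; an $\mathbf{L}$-space is a linear space endowed with an $\mathbf{L}$-norm. For a linear operator $\varphi:G\to E$ between $\mathbf{L}$-spaces put $\varphi_\infty:=\mathbf{1}_{\mathbf{L}}\otimes\varphi$;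 $\varphi$ is $\mathbf{L}$-contractive if $\|\varphi_\infty\|\le 1$. $\mathcal{CC}(G,E)$ is the set of $\mathbf{L}$-contractive operators $G\to E$. $\mathbf{L}\mathbf{Nor}_1$ is the category of $\mathbf{L}$-spaces and $\mathbf{L}$-contractive operators. A subspace of $\mathbf{L}$ is contractively complemented if it is the range of a projection on $\mathbf{L}$ of norm at most $1$. Let $B^\nu_E$ be the closed unit ball of $L^\nu\otimes E$ (with the norm induced from $\mathbf{L}\otimes E$). The functor $\odot:\mathbf{L}\mathbf{Nor}_1\to\mathbf{Set}$ takes $E$ to $\prod_{\nu\in\Lambda}B^\nu_E$ and $\varphi\in\mathcal{CC}(G,E)$ to $(v_\nu)_\nu\mapsto(\varphi_\infty(v_\nu))_\nu$. For a family $(E_i)_i$ of $\mathbf{L}$-spaces, the $\oplus_1$-sum $(\oplus_iE_i)_1$ is the algebraic direct sum $\oplus_iE_i$, where $\mathbf{L}\otimes(\oplus_iE_i)$ is identified with $\oplus_i(\mathbf{L}\otimes E_i)$ and normed by $\|(u_i)\|=\sum_i\|u_i\|$ (no completion). For a functor $\square:\mathbf{L}\mathbf{Nor}_1\to\mathbf{Set}$ and a set $M$, an $\mathbf{L}$-space $\mathbf{F}$ is called a $\square$-free $\mathbf{L}$-space with the base $M$ if for every $\mathbf{L}$-space $E$ there is a bijection $\mathbf{I}_E:\mathbf{Set}(M,\square E)\to\mathcal{CC}(\mathbf{F},E)$, and these bijections are natural: $\varphi\circ\mathbf{I}_G(f)=\mathbf{I}_E((\square\varphi)\circ f)$ for all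 $\varphi\in\mathcal{CC}(G,E)$ and $f:M\to\square G$. *)

theory Defs
  imports "HOL-Analysis.Operator_Norm" "HOL-Library.FuncSet" "HOL-Library.Function_Algebras"
begin

text \<open>The scalar field is isometrically isomorphic to the reals or to the complex numbers.\<close>

class real_or_complex = real_normed_field +
  assumes real_or_complex: "\<exists>f :: 'a \<Rightarrow> complex.
    (\<forall>x y. f (x + y) = f x + f y) \<and> (\<forall>x y. f (x * y) = f x * f y) \<and>
    (\<forall>x. norm (f x) = norm x) \<and> (range f = \<real> \<or> range f = UNIV)"

instance real :: real_or_complex
proof
  show "\<exists>f :: real \<Rightarrow> complex.
    (\<forall>x y. f (x + y) = f x + f y) \<and> (\<forall>x y. f (x * y) = f x * f y) \<and>
    (\<forall>x. norm (f x) = norm x) \<and> (range f = \<real> \<or> range f = UNIV)"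
    by (rule exI[of _ complex_of_real]) (auto simp: Reals_def)
qed

instance complex :: real_or_complex
proof
  show "\<exists>f :: complex \<Rightarrow> complex.
    (\<forall>x y. f (x + y) = f x + f y) \<and> (\<forall>x y. f (x * y) = f x * f y) \<and>
    (\<forall>x. norm (f x) = norm x) \<and> (range f = \<real> \<or> range f = UNIV)"
    by (rule exI[of _ "\<lambda>x. x"]) auto
qed

text \<open>A normed space over \<open>'k\<close> is its underlying real normed space together with a compatible
  multiplication by scalars from \<open>'k\<close>.\<close>

locale normed_space_over = vector_space scale
  for scale :: "'k::real_or_complex \<Rightarrow> 'l::real_normed_vector \<Rightarrow> 'l" +
  assumes norm_scale: "norm (scale c x) = norm c * norm x"
    and scale_of_real: "scale (of_real r) x = r *\<^sub>R x"

definition bounded_operators ::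
    "('k::real_or_complex \<Rightarrow> 'l::real_normed_vector \<Rightarrow> 'l) \<Rightarrow> ('l \<Rightarrow> 'l) set" where
  "bounded_operators sL = {a. bounded_linear a \<and> (\<forall>c x. a (sL c x) = sL c (a x))}"

definition finite_dim ::
    "('k::real_or_complex \<Rightarrow> 'l::real_normed_vector \<Rightarrow> 'l) \<Rightarrow> 'l set \<Rightarrow> bool" where
  "finite_dim sL S \<longleftrightarrow> (\<exists>B. finite B \<and> module.span sL B = S)"

definition contractively_complemented ::
    "('k::real_or_complex \<Rightarrow> 'l::real_normed_vector \<Rightarrow> 'l) \<Rightarrow> 'l set \<Rightarrow> bool" where
  "contractively_complemented sL S \<longleftrightarrow>
     (\<exists>P \<in> bounded_operators sL. P \<circ> P = P \<and> onorm P \<le> 1 \<and> range P = S)"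

definition linear_on ::
    "('k \<Rightarrow> 'a::ab_group_add \<Rightarrow> 'a) \<Rightarrow> ('k \<Rightarrow> 'b::ab_group_add \<Rightarrow> 'b) \<Rightarrow> 'a set \<Rightarrow> ('a \<Rightarrow> 'b) \<Rightarrow> bool"
  where
  "linear_on s1 s2 V f \<longleftrightarrow>
     (\<forall>x\<in>V. \<forall>y\<in>V. f (x + y) = f x + f y) \<and> (\<forall>c. \<forall>x\<in>V. f (s1 c x) = s2 c (f x))"

text \<open>Linear functionals of norm at most 1 on the space \<open>V\<close> normed by \<open>n\<close>; only their values
  on \<open>V\<close> matter.\<close>

definition unit_functionals ::
    "('k::real_or_complex \<Rightarrow> 'a::ab_group_add \<Rightarrow> 'a) \<Rightarrow> 'a set \<Rightarrow> ('a \<Rightarrow> real) \<Rightarrow> ('a \<Rightarrow> 'k) set" where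
  "unit_functionals s V n = {g. linear_on s (*) V g \<and> (\<forall>x\<in>V. norm (g x) \<le> n x)}"

text \<open>A linear space is a linear subspace \<open>V\<close> of an ambient vector space of type \<open>'e\<close>, so that
  spaces of different sizes can live in one type. The algebraic tensor product of \<open>L\<close> and \<open>V\<close> is
  realised as a space of functionals on the bilinear forms on \<open>L \<times> V\<close>: the elementary tensor
  of \<open>\<xi>\<close> and \<open>x\<close> is the evaluation \<open>B \<mapsto> B \<xi> x\<close>, and the tensor product is the span
  of these. Tensors vanish, by convention, at functions that are not bilinear forms on
  \<open>L \<times> V\<close>.\<close>

type_synonym ('k, 'l, 'e) tensor = "('l \<Rightarrow> 'e \<Rightarrow> 'k) \<Rightarrow> 'k"

text \<open>The last field is the norm on the tensor product; only its values there matter.\<close>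

record ('k, 'l, 'e) lspace =
  carr :: "'e set"
  scal :: "'k \<Rightarrow> 'e \<Rightarrow> 'e"
  lnorm :: "('k, 'l, 'e) tensor \<Rightarrow> real"

definition bilinear_forms ::
    "('k::real_or_complex \<Rightarrow> 'l::real_normed_vector \<Rightarrow> 'l) \<Rightarrow> ('k, 'l, 'e::ab_group_add) lspace
      \<Rightarrow> ('l \<Rightarrow> 'e \<Rightarrow> 'k) set" where
  "bilinear_forms sL E =
     {B. (\<forall>x\<in>carr E. linear_on sL (*) UNIV (\<lambda>\<xi>. B \<xi> x)) \<and>
         (\<forall>\<xi>. linear_on (scal E) (*) (carr E) (B \<xi>))}"

definition elem_tensor ::
    "('k::real_or_complex \<Rightarrow> 'l::real_normed_vector \<Rightarrow> 'l) \<Rightarrow> ('k, 'l, 'e::ab_group_add) lspace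
      \<Rightarrow> 'l \<Rightarrow> 'e \<Rightarrow> ('k, 'l, 'e) tensor" where
  "elem_tensor sL E \<xi> x = (\<lambda>B. if B \<in> bilinear_forms sL E then B \<xi> x else 0)"

definition tensor_scale :: "'k::real_or_complex \<Rightarrow> ('k, 'l, 'e) tensor \<Rightarrow> ('k, 'l, 'e) tensor" where
  "tensor_scale c u = (\<lambda>B. c * u B)"

text \<open>\<open>tensor_space sL S E\<close> is the tensor product of the subspace \<open>S\<close> of \<open>L\<close> with \<open>E\<close>, as a
  subspace of the tensor product \<open>tensor_space sL UNIV E\<close> of \<open>L\<close> with \<open>E\<close>.\<close>

definition tensor_space ::
    "('k::real_or_complex \<Rightarrow> 'l::real_normed_vector \<Rightarrow> 'l) \<Rightarrow> 'l set
      \<Rightarrow> ('k, 'l, 'e::ab_group_add) lspace \<Rightarrow> ('k, 'l, 'e) tensor set" where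
  "tensor_space sL S E =
     module.span tensor_scale {elem_tensor sL E \<xi> x | \<xi> x. \<xi> \<in> S \<and> x \<in> carr E}"

text \<open>The tensor product of operators \<open>a\<close> on \<open>L\<close> and \<open>\<phi>\<close> from some space to \<open>E\<close>; it takes
  the elementary tensor of \<open>\<xi>\<close> and \<open>x\<close> to that of \<open>a \<xi>\<close> and \<open>\<phi> x\<close>. The case distinction is
  needed because \<open>B \<circ> (a \<times> \<phi>)\<close> can be a bilinear form without \<open>B\<close> being one.\<close>

definition tensor_map ::
    "('k::real_or_complex \<Rightarrow> 'l::real_normed_vector \<Rightarrow> 'l) \<Rightarrow> ('k, 'l, 'e::ab_group_add) lspace
      \<Rightarrow> ('l \<Rightarrow> 'l) \<Rightarrow> ('g \<Rightarrow> 'e) \<Rightarrow> ('k, 'l, 'g) tensor \<Rightarrow> ('k, 'l, 'e) tensor" where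
  "tensor_map sL E a \<phi> u =
     (\<lambda>B. if B \<in> bilinear_forms sL E then u (\<lambda>\<xi> x. B (a \<xi>) (\<phi> x)) else 0)"

abbreviation act ::
    "('k::real_or_complex \<Rightarrow> 'l::real_normed_vector \<Rightarrow> 'l) \<Rightarrow> ('k, 'l, 'e::ab_group_add) lspace
      \<Rightarrow> ('l \<Rightarrow> 'l) \<Rightarrow> ('k, 'l, 'e) tensor \<Rightarrow> ('k, 'l, 'e) tensor" where
  "act sL E a \<equiv> tensor_map sL E a (\<lambda>x. x)"

abbreviation amplification ::
    "('k::real_or_complex \<Rightarrow> 'l::real_normed_vector \<Rightarrow> 'l) \<Rightarrow> ('k, 'l, 'e::ab_group_add) lspace
      \<Rightarrow> ('g \<Rightarrow> 'e) \<Rightarrow> ('k, 'l, 'g) tensor \<Rightarrow> ('k, 'l, 'e) tensor" where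
  "amplification sL E \<phi> \<equiv> tensor_map sL E (\<lambda>\<xi>. \<xi>) \<phi>"

definition is_lspace ::
    "('k::real_or_complex \<Rightarrow> 'l::real_normed_vector \<Rightarrow> 'l) \<Rightarrow> ('k, 'l, 'e::ab_group_add) lspace
      \<Rightarrow> bool" where
  "is_lspace sL E \<longleftrightarrow>
     vector_space (scal E) \<and> module.subspace (scal E) (carr E) \<and>
     (\<forall>u\<in>tensor_space sL UNIV E. lnorm E u \<ge> 0 \<and> (lnorm E u = 0 \<longleftrightarrow> u = 0)) \<and>
     (\<forall>u\<in>tensor_space sL UNIV E. \<forall>c. lnorm E (tensor_scale c u) = norm c * lnorm E u) \<and>
     (\<forall>u\<in>tensor_space sL UNIV E. \<forall>v\<in>tensor_space sL UNIV E.
        lnorm E (u + v) \<le> lnorm E u + lnorm E v) \<and>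
     (\<forall>a\<in>bounded_operators sL. \<forall>u\<in>tensor_space sL UNIV E.
        lnorm E (act sL E a u) \<le> onorm a * lnorm E u)"

text \<open>Morphisms are extensional, so that two of them are equal iff they agree on \<open>carr G\<close>.\<close>

definition CC ::
    "('k::real_or_complex \<Rightarrow> 'l::real_normed_vector \<Rightarrow> 'l) \<Rightarrow> ('k, 'l, 'g::ab_group_add) lspace
      \<Rightarrow> ('k, 'l, 'e::ab_group_add) lspace \<Rightarrow> ('g \<Rightarrow> 'e) set" where
  "CC sL G E =
     {\<phi> \<in> carr G \<rightarrow>\<^sub>E carr E. linear_on (scal G) (scal E) (carr G) \<phi> \<and>
        (\<forall>u\<in>tensor_space sL UNIV G. lnorm E (amplification sL E \<phi> u) \<le> lnorm G u)}"

text \<open>A functor to sets is given by its object map \<open>Sq\<close> and its morphism map \<open>Sqm\<close>, where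
  \<open>Sqm G E \<phi>\<close> is the image of \<open>\<phi> : G \<rightarrow> E\<close>. The objects of its domain are all L-spaces carried by
  subsets of the type \<open>'e\<close>; as \<open>'e\<close> is arbitrary, it can accommodate any set of L-spaces.\<close>

definition free_lspace ::
    "('k::real_or_complex \<Rightarrow> 'l::real_normed_vector \<Rightarrow> 'l)
      \<Rightarrow> (('k, 'l, 'e::ab_group_add) lspace \<Rightarrow> 's set)
      \<Rightarrow> (('k, 'l, 'e) lspace \<Rightarrow> ('k, 'l, 'e) lspace \<Rightarrow> ('e \<Rightarrow> 'e) \<Rightarrow> 's \<Rightarrow> 's)
      \<Rightarrow> 't set \<Rightarrow> ('k, 'l, 'f::ab_group_add) lspace \<Rightarrow> bool" where
  "free_lspace sL Sq Sqm M F \<longleftrightarrow>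
     is_lspace sL F \<and>
     (\<exists>I :: ('k, 'l, 'e) lspace \<Rightarrow> ('t \<Rightarrow> 's) \<Rightarrow> ('f \<Rightarrow> 'e).
        (\<forall>E. is_lspace sL E \<longrightarrow> bij_betw (I E) (M \<rightarrow>\<^sub>E Sq E) (CC sL F E)) \<and>
        (\<forall>G E. is_lspace sL G \<longrightarrow> is_lspace sL E \<longrightarrow>
           (\<forall>\<phi>\<in>CC sL G E. \<forall>f\<in>M \<rightarrow>\<^sub>E Sq G.
              compose (carr F) \<phi> (I G f) = I E (compose M (Sqm G E \<phi>) f))))"

definition odot_obj ::
    "('k::real_or_complex \<Rightarrow> 'l::real_normed_vector \<Rightarrow> 'l) \<Rightarrow> 'i set \<Rightarrow> ('i \<Rightarrow> 'l set)
      \<Rightarrow> ('k, 'l, 'e::ab_group_add) lspace \<Rightarrow> ('i \<Rightarrow> ('k, 'l, 'e) tensor) set" where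
  "odot_obj sL \<Lambda> Lsub E = (\<Pi>\<^sub>E \<nu>\<in>\<Lambda>. {v \<in> tensor_space sL (Lsub \<nu>) E. lnorm E v \<le> 1})"

definition odot_mor ::
    "('k::real_or_complex \<Rightarrow> 'l::real_normed_vector \<Rightarrow> 'l) \<Rightarrow> 'i set
      \<Rightarrow> ('k, 'l, 'e::ab_group_add) lspace \<Rightarrow> ('k, 'l, 'e) lspace \<Rightarrow> ('e \<Rightarrow> 'e)
      \<Rightarrow> ('i \<Rightarrow> ('k, 'l, 'e) tensor) \<Rightarrow> ('i \<Rightarrow> ('k, 'l, 'e) tensor)" where
  "odot_mor sL \<Lambda> G E \<phi> v = (\<lambda>\<nu>\<in>\<Lambda>. amplification sL E \<phi> (v \<nu>))"

text \<open>The component of a tensor \<open>u\<close> in the tensor product of \<open>L\<close> with \<open>E i\<close> is obtained by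
  amplifying the coordinate projection; only finitely many components are nonzero.\<close>

definition oplus1 ::
    "('k::real_or_complex \<Rightarrow> 'l::real_normed_vector \<Rightarrow> 'l) \<Rightarrow> 'j set
      \<Rightarrow> ('j \<Rightarrow> ('k, 'l, 'e::ab_group_add) lspace) \<Rightarrow> ('k, 'l, 'j \<Rightarrow> 'e) lspace" where
  "oplus1 sL J E =
     \<lparr> carr = {x. finite {j. x j \<noteq> 0} \<and> (\<forall>j\<in>J. x j \<in> carr (E j)) \<and> (\<forall>j. j \<notin> J \<longrightarrow> x j = 0)},
       scal = (\<lambda>c x j. scal (E j) c (x j)),
       lnorm = (\<lambda>u. \<Sum>j | j \<in> J \<and> amplification sL (E j) (\<lambda>x. x j) u \<noteq> 0.
                      lnorm (E j) (amplification sL (E j) (\<lambda>x. x j) u)) \<rparr>"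

text \<open>The minimal norm is the injective tensor norm of \<open>L\<close> and the space \<open>V\<close> normed by
  \<open>n\<close>: the supremum over products of functionals in the two dual unit balls.\<close>

definition minimal_lspace ::
    "('k::real_or_complex \<Rightarrow> 'l::real_normed_vector \<Rightarrow> 'l) \<Rightarrow> 'v set
      \<Rightarrow> ('k \<Rightarrow> 'v::ab_group_add \<Rightarrow> 'v) \<Rightarrow> ('v \<Rightarrow> real) \<Rightarrow> ('k, 'l, 'v) lspace" where
  "minimal_lspace sL V s n =
     \<lparr> carr = V, scal = s,
       lnorm = (\<lambda>u. SUP (f, g) \<in> unit_functionals sL UNIV norm \<times> unit_functionals s V n.
                      norm (u (\<lambda>\<xi> x. f \<xi> * g x))) \<rparr>"

text \<open>Functionals on the subspace \<open>S\<close> are extended by 0 to all of \<open>L\<close> (not linearly).\<close>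

definition dual_carr ::
    "('k::real_or_complex \<Rightarrow> 'l::real_normed_vector \<Rightarrow> 'l) \<Rightarrow> 'l set \<Rightarrow> ('l \<Rightarrow> 'k) set" where
  "dual_carr sL S = {f. linear_on sL (*) S f \<and> (\<exists>C. \<forall>x\<in>S. norm (f x) \<le> C * norm x) \<and>
                        (\<forall>x. x \<notin> S \<longrightarrow> f x = 0)}"

definition dual_norm :: "'l::real_normed_vector set \<Rightarrow> ('l \<Rightarrow> 'k::real_or_complex) \<Rightarrow> real" where
  "dual_norm S f = (SUP x \<in> {x\<in>S. norm x \<le> 1}. norm (f x))"

definition F_nu ::
    "('k::real_or_complex \<Rightarrow> 'l::real_normed_vector \<Rightarrow> 'l) \<Rightarrow> 'l set \<Rightarrow> ('k, 'l, 'l \<Rightarrow> 'k) lspace"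
  where
  "F_nu sL S = minimal_lspace sL (dual_carr sL S) (\<lambda>c f x. c * f x) (dual_norm S)"

definition F_star ::
    "('k::real_or_complex \<Rightarrow> 'l::real_normed_vector \<Rightarrow> 'l) \<Rightarrow> 'i set \<Rightarrow> ('i \<Rightarrow> 'l set)
      \<Rightarrow> ('k, 'l, 'i \<Rightarrow> 'l \<Rightarrow> 'k) lspace" where
  "F_star sL \<Lambda> Lsub = oplus1 sL \<Lambda> (\<lambda>\<nu>. F_nu sL (Lsub \<nu>))"

definition F_base ::
    "('k::real_or_complex \<Rightarrow> 'l::real_normed_vector \<Rightarrow> 'l) \<Rightarrow> 'i set \<Rightarrow> ('i \<Rightarrow> 'l set)
      \<Rightarrow> 't set \<Rightarrow> ('k, 'l, 't \<Rightarrow> 'i \<Rightarrow> 'l \<Rightarrow> 'k) lspace" where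
  "F_base sL \<Lambda> Lsub M = oplus1 sL M (\<lambda>t. F_star sL \<Lambda> Lsub)"

end

theory Submission
  imports Defs
begin

text \<open>
  By the Yoneda lemma, a natural bijection from \<open>CC F E\<close> to a product of unit balls of spaces
  \<open>S\<^sub>j \<otimes> E\<close> amounts to a family of universal tensors \<open>w\<^sub>j \<in> S\<^sub>j \<otimes> F\<close> of norm at most 1: every
  family \<open>v\<^sub>j\<close> in these balls is the image of \<open>w\<^sub>j\<close> under the amplification of a unique
  \<open>\<phi> \<in> CC F E\<close>. Universal families of the summands together form one of an \<open>\<oplus>\<^sub>1\<close>-sum, so it remains
  to treat the dual of a single subspace \<open>S\<close> that is the range of a contractive projection \<open>P\<close>.

  There \<open>w = \<Sum> e\<^sub>i \<otimes> f\<^sub>i\<close>, where the \<open>e\<^sub>i\<close> span \<open>S\<close> and the \<open>f\<^sub>i\<close> are corresponding coordinate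
  functionals. Every tensor in \<open>L \<otimes> S\<^sup>*\<close> is \<open>T \<cdot> w\<close> for a bounded operator \<open>T\<close> on \<open>L\<close> with \<open>T P = T\<close>, and,
  by the Hahn-Banach theorem, its minimal norm is the operator norm of \<open>T\<close>. If the amplification of
  \<open>\<phi>\<close> takes \<open>w\<close> to \<open>v\<close>, then it takes \<open>T \<cdot> w\<close> to \<open>T \<cdot> v\<close>, whose norm is at most \<open>\<parallel>T\<parallel> \<parallel>v\<parallel>\<close>; hence
  \<open>\<phi>\<close> is contractive as soon as \<open>v\<close> lies in the unit ball.
\<close>

section \<open>Norming functionals\<close>

text \<open>Homogeneity is required only as an inequality, since that form passes easily to infima;
  applying it to the inverse scalar as well gives equality for \<open>r > 0\<close>.\<close>

definition sublinear :: "('a::real_vector \<Rightarrow> real) \<Rightarrow> bool" where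
  "sublinear p \<longleftrightarrow> (\<forall>x y. p (x + y) \<le> p x + p y) \<and> (\<forall>r\<ge>0. \<forall>x. p (r *\<^sub>R x) \<le> r * p x)"

lemma sublinear_add: "sublinear p \<Longrightarrow> p (x + y) \<le> p x + p y"
  by (simp add: sublinear_def)

lemma sublinear_scaleR_le: "sublinear p \<Longrightarrow> 0 \<le> r \<Longrightarrow> p (r *\<^sub>R x) \<le> r * p x"
  by (simp add: sublinear_def)

lemma sublinear_0: "sublinear p \<Longrightarrow> p 0 = 0"
  using sublinear_add[of p 0 0] sublinear_scaleR_le[of p 0 0] by simp

lemma sublinear_scaleR:
  assumes "sublinear p" "0 \<le> r"
  shows "p (r *\<^sub>R x) = r * p x"
proof (cases "r = 0")
  case True
  then show ?thesis using sublinear_0[OF assms(1)] by simp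
next
  case False
  then have "p x \<le> inverse r * p (r *\<^sub>R x)"
    using sublinear_scaleR_le[OF assms(1), of "inverse r" "r *\<^sub>R x"] assms(2) by simp
  then have "r * p x \<le> p (r *\<^sub>R x)"
    using False assms(2) by (simp add: field_simps)
  then show ?thesis using sublinear_scaleR_le[OF assms, of x] by simp
qed

lemma sublinear_ge_minus: "sublinear p \<Longrightarrow> - p (- x) \<le> p x"
  using sublinear_add[of p x "- x"] sublinear_0[of p] by simp

text \<open>A minimal sublinear functional \<open>q\<close> satisfies \<open>lowering q y = q\<close> for all \<open>y\<close>, which makes it
  additive; this replaces the extension step in the usual proof of the Hahn-Banach theorem.\<close>

definition lowering :: "('a::real_vector \<Rightarrow> real) \<Rightarrow> 'a \<Rightarrow> 'a \<Rightarrow> real" where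
  "lowering p y x = (INF t\<in>{0..}. p (x + t *\<^sub>R y) - t * p y)"

context
  fixes p :: "'a::real_vector \<Rightarrow> real"
  assumes p: "sublinear p"
begin

lemma lowering_le:
  assumes "0 \<le> t"
  shows "lowering p y x \<le> p (x + t *\<^sub>R y) - t * p y"
  unfolding lowering_def
proof (rule cINF_lower)
  \<comment> \<open>Subadditivity for \<open>x + t *\<^sub>R y\<close> and \<open>- x\<close> gives
    a lower bound independent of \<open>t\<close>, so the infimum is a genuine one.\<close>
  have "- p (- x) \<le> p (x + t *\<^sub>R y) - t * p y" if "0 \<le> t" for t
    using sublinear_add[OF p, of "x + t *\<^sub>R y" "- x"] sublinear_scaleR[OF p that, of y] by simp
  then show "bdd_below ((\<lambda>t. p (x + t *\<^sub>R y) - t * p y) ` {0..})"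
    by (intro bdd_belowI2[of _ "- p (- x)"]) auto
qed (use assms in simp)

lemma lowering_greatest:
  assumes "\<And>t. 0 \<le> t \<Longrightarrow> c \<le> p (x + t *\<^sub>R y) - t * p y"
  shows "c \<le> lowering p y x"
  unfolding lowering_def using assms by (intro cINF_greatest) auto

lemma lowering_le_self: "lowering p y x \<le> p x"
  using lowering_le[of 0 y x] by simp

text \<open>Parameters \<open>s\<close> and \<open>t\<close> for the two summands combine to
  \<open>s + t\<close> for the sum, and a parameter \<open>t\<close> for \<open>x\<close> becomes
  \<open>r * t\<close> for the multiple of \<open>x\<close> by \<open>r\<close>.\<close>

lemma sublinear_lowering: "sublinear (lowering p y)"
  unfolding sublinear_def
proof (intro conjI allI impI)
  fix x x'
  have "lowering p y (x + x') \<le> (p (x + s *\<^sub>R y) - s * p y) + (p (x' + t *\<^sub>R y) - t * p y)"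
    if "0 \<le> s" "0 \<le> t" for s t
    using lowering_le[of "s + t" y "x + x'"] that
      sublinear_add[OF p, of "x + s *\<^sub>R y" "x' + t *\<^sub>R y"]
    by (simp add: algebra_simps)
  then have "lowering p y (x + x') - (p (x' + t *\<^sub>R y) - t * p y) \<le> lowering p y x" if "0 \<le> t" for t
    using that by (intro lowering_greatest) (simp add: algebra_simps)
  then have "lowering p y (x + x') - lowering p y x \<le> lowering p y x'"
    by (intro lowering_greatest) (simp add: algebra_simps)
  then show "lowering p y (x + x') \<le> lowering p y x + lowering p y x'" by simp
next
  fix r :: real and x
  assume r: "0 \<le> r"
  have *: "lowering p y (r *\<^sub>R x) \<le> r * (p (x + t *\<^sub>R y) - t * p y)" if "0 \<le> t" for t
    using lowering_le[of "r * t" y "r *\<^sub>R x"] that r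
      sublinear_scaleR[OF p r, of "x + t *\<^sub>R y"]
    by (simp add: algebra_simps)
  show "lowering p y (r *\<^sub>R x) \<le> r * lowering p y x"
  proof (cases "r = 0")
    case True
    then show ?thesis using *[of 0] by simp
  next
    case False
    then have "lowering p y (r *\<^sub>R x) / r \<le> lowering p y x"
      using * r by (intro lowering_greatest) (simp add: field_simps)
    then show ?thesis using False r by (simp add: field_simps)
  qed
qed

end

text \<open>Zorn's lemma for the reversed pointwise order: the lower bound of a nonempty chain is
  its pointwise infimum, which is finite because every member of the chain is at least
  \<open>- p (- x)\<close> at \<open>x\<close>.\<close>

lemma exists_minimal_sublinear:
  fixes p :: "'a::real_vector \<Rightarrow> real"
  assumes p: "sublinear p"
  obtains q where "sublinear q" "q \<le> p" "\<forall>q'. sublinear q' \<longrightarrow> q' \<le> q \<longrightarrow> q' = q"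
proof -
  define A where "A = {q. sublinear q \<and> q \<le> p}"
  let ?P = "\<lambda>a b :: 'a \<Rightarrow> real. b \<le> a"
  have "\<exists>m\<in>A. \<forall>a\<in>A. ?P m a \<longrightarrow> a = m"
  proof (rule predicate_Zorn)
    show "partial_order_on A (relation_of ?P A)"
      by (rule partial_order_on_relation_ofI) auto
  next
    fix C assume C: "C \<in> Chains (relation_of ?P A)"
    show "\<exists>u\<in>A. \<forall>a\<in>C. ?P a u"
    proof (cases "C = {}")
      case True
      then show ?thesis using p by (auto simp: A_def)
    next
      case False
      have CA: "sublinear q" "q \<le> p" if "q \<in> C" for q
        using C that by (auto simp: Chains_def relation_of_def A_def)
      have total: "q1 \<le> q2 \<or> q2 \<le> q1" if "q1 \<in> C" "q2 \<in> C" for q1 q2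
        using C that by (auto simp: Chains_def relation_of_def)
      define u where "u x = (INF q\<in>C. q x)" for x
      have "- p (- x) \<le> q x" if "q \<in> C" for q x
        using sublinear_ge_minus[OF CA(1)[OF that], of x] le_funD[OF CA(2)[OF that], of "- x"]
        by linarith
      then have u_le: "u x \<le> q x" if "q \<in> C" for q x
        unfolding u_def using that by (intro cINF_lower bdd_belowI2[of _ "- p (- x)"]) auto
      have u_greatest: "c \<le> u x" if "\<And>q. q \<in> C \<Longrightarrow> c \<le> q x" for c x
        unfolding u_def using that False by (intro cINF_greatest) auto
      have "sublinear u"
        unfolding sublinear_def
      proof (intro conjI allI impI)
        fix x y
        \<comment> \<open>The smaller of the two members of the chain bounds the left-hand side;
          this is where the chain property enters.\<close>
        have "u (x + y) \<le> q1 x + q2 y" if "q1 \<in> C" "q2 \<in> C" for q1 q2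
          using total[OF that]
        proof
          assume "q1 \<le> q2"
          then show ?thesis
            using u_le[OF that(1), of "x + y"] sublinear_add[OF CA(1)[OF that(1)], of x y]
              le_funD[of q1 q2 y] by linarith
        next
          assume "q2 \<le> q1"
          then show ?thesis
            using u_le[OF that(2), of "x + y"] sublinear_add[OF CA(1)[OF that(2)], of x y]
              le_funD[of q2 q1 x] by linarith
        qed
        then have "u (x + y) - q2 y \<le> u x" if "q2 \<in> C" for q2
          using that by (intro u_greatest) (simp add: algebra_simps)
        then have "u (x + y) - u x \<le> u y"
          by (intro u_greatest) (simp add: algebra_simps)
        then show "u (x + y) \<le> u x + u y" by simp
      next
        fix r :: real and x
        assume r: "0 \<le> r"
        have *: "u (r *\<^sub>R x) \<le> r * q x" if "q \<in> C" for q
          using u_le[OF that, of "r *\<^sub>R x"] sublinear_scaleR[OF CA(1)[OF that] r, of x] by simp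
        show "u (r *\<^sub>R x) \<le> r * u x"
        proof (cases "r = 0")
          case True
          then show ?thesis using * False by auto
        next
          case False
          then have "u (r *\<^sub>R x) / r \<le> u x"
            using * r by (intro u_greatest) (simp add: field_simps)
          then show ?thesis using False r by (simp add: field_simps)
        qed
      qed
      moreover have "u \<le> p"
      proof (rule le_funI)
        fix x
        obtain q where "q \<in> C" using False by blast
        then show "u x \<le> p x"
          using u_le[of q x] le_funD[OF CA(2), of q x] by linarith
      qed
      ultimately show ?thesis
        using u_le by (intro bexI[of _ u]) (auto simp: A_def le_fun_def)
    qed
  qed
  then obtain q where q: "sublinear q" "q \<le> p"
    and min: "\<And>q'. sublinear q' \<Longrightarrow> q' \<le> p \<Longrightarrow> q' \<le> q \<Longrightarrow> q' = q"
    by (auto simp: A_def)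
  from q show thesis
    by (rule that) (use min q(2) order_trans in blast)
qed

lemma exists_linear_le_sublinear:
  assumes "sublinear p"
  obtains h where "linear h" "\<forall>x. h x \<le> p x"
proof -
  obtain q where q: "sublinear q" "q \<le> p" "\<forall>q'. sublinear q' \<longrightarrow> q' \<le> q \<longrightarrow> q' = q"
    using exists_minimal_sublinear[OF assms] by blast
  have "q x + q y \<le> q (x + y)" for x y
  proof -
    \<comment> \<open>Minimality makes lowering trivial; taking \<open>t = 1\<close> in the infimum
      then gives superadditivity.\<close>
    have "lowering q y = q"
      using sublinear_lowering[OF q(1)] lowering_le_self[OF q(1)] by (intro q(3)[rule_format]) (auto simp: le_fun_def)
    then show ?thesis using lowering_le[OF q(1), of 1 y x] by simp
  qed
  then have add: "q (x + y) = q x + q y" for x y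
    using sublinear_add[OF q(1), of x y] by (simp add: antisym)
  \<comment> \<open>For negative \<open>r\<close>, additivity at \<open>r *\<^sub>R x\<close> and
    its negative reduces the claim to the nonnegative scalar \<open>- r\<close>.\<close>
  have "q (r *\<^sub>R x) = r * q x" for r x
  proof (cases "0 \<le> r")
    case False
    then show ?thesis
      using sublinear_scaleR[OF q(1), of "- r" x] add[of "r *\<^sub>R x" "- (r *\<^sub>R x)"]
        sublinear_0[OF q(1)] by simp
  qed (rule sublinear_scaleR[OF q(1)])
  with add have "linear q" by (intro linearI) auto
  then show thesis using q(2) by (intro that[of q]) (auto simp: le_fun_def)
qed

text \<open>Instead of extending a functional from the line through \<open>x0\<close>, the norm is
  first lowered in the direction \<open>x0\<close>. The parameter \<open>t = 1\<close> shows that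
  the lowered norm is at most \<open>- norm x0\<close> at \<open>- x0\<close>, which forces every
  linear minorant to attain \<open>norm x0\<close> at \<open>x0\<close>.\<close>

lemma exists_real_norming_functional:
  fixes x0 :: "'a::real_normed_vector"
  obtains h where "linear h" "\<forall>x. h x \<le> norm x" "h x0 = norm x0"
proof -
  have n: "sublinear (norm :: 'a \<Rightarrow> real)"
    by (simp add: sublinear_def norm_triangle_ineq)
  obtain h where h: "linear h" "\<forall>x. h x \<le> lowering norm x0 x"
    using exists_linear_le_sublinear[OF sublinear_lowering[OF n, of x0]] by blast
  have le: "h x \<le> norm x" for x
    using h(2) lowering_le_self[OF n, of x0 x] order_trans by metis
  have "h (- x0) \<le> - norm x0"
    using h(2)[rule_format, of "- x0"] lowering_le[OF n, of 1 x0 "- x0"] by simp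
  then have "h x0 = norm x0"
    using le[of x0] linear_neg[OF h(1), of x0] by simp
  with h(1) le show thesis by (intro that[of h]) auto
qed

text \<open>Replaces the abstract embedding into the complex numbers by an internal description: all
  scalars are real, or there is an imaginary unit \<open>j\<close> and the modulus dominates the
  real part.\<close>

lemma real_or_complex_cases:
  obtains (real) "\<And>c :: 'k::real_or_complex. \<exists>r. c = of_real r"
  | (complex) j :: "'k::real_or_complex" where "j * j = - 1" "\<And>c. \<exists>a b. c = of_real a + of_real b * j"
      "\<And>a b. \<bar>a\<bar> \<le> norm (of_real a + of_real b * j)"
proof -
  obtain f :: "'k \<Rightarrow> complex" where f: "\<And>x y. f (x + y) = f x + f y" "\<And>x y. f (x * y) = f x * f y"
    "\<And>x. norm (f x) = norm x" "range f = \<real> \<or> range f = UNIV"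
    using real_or_complex by blast
  have f0: "f 0 = 0" using f(3)[of 0] by simp
  have fm: "f (- x) = - f x" for x using f(1)[of x "- x"] f0 by (simp add: eq_neg_iff_add_eq_0 add.commute)
  have fd: "f (x - y) = f x - f y" for x y using f(1)[of x "- y"] fm[of y] by simp
  have inj: "x = y" if "f x = f y" for x y
    using f(3)[of "x - y"] that by (simp add: fd)
  have f1: "f 1 = 1" using f(2)[of 1 1] f(3)[of 1] by auto
  \<comment> \<open>The embedding is not assumed to fix the reals. It is an isometry fixing 0 and 1,
    so the image of \<open>r\<close> has the same distances to 0 and 1 as \<open>r\<close> itself,
    and these determine it.\<close>
  have fr: "f (of_real r) = of_real r" for r
  proof -
    let ?z = "f (of_real r)"
    have a: "(Re ?z)\<^sup>2 + (Im ?z)\<^sup>2 = r\<^sup>2"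
      using f(3)[of "of_real r"] by (simp flip: cmod_power2)
    have "cmod (?z - 1) = \<bar>r - 1\<bar>"
      using f(3)[of "of_real (r - 1)"] by (simp only: of_real_diff of_real_1 fd f1) (metis norm_of_real of_real_1 of_real_diff)
    then have "(cmod (?z - 1))\<^sup>2 = (r - 1)\<^sup>2" by simp
    then have "(Re ?z - 1)\<^sup>2 + (Im ?z)\<^sup>2 = (r - 1)\<^sup>2"
      by (simp add: cmod_power2)
    with a have "Re ?z = r" by (simp add: power2_eq_square algebra_simps)
    with a show ?thesis by (simp add: complex_eq_iff)
  qed
  from f(4) show thesis
  proof
    assume R: "range f = \<real>"
    show thesis
    proof (rule real)
      fix c
      have "f c \<in> \<real>" using R by blast
      then obtain r where "f c = of_real r" by (auto simp: Reals_def)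
      then show "\<exists>r. c = of_real r" using inj fr by metis
    qed
  next
    assume "range f = UNIV"
    then obtain i where i: "f i = \<i>" by (metis surj_def)
    have v: "f (of_real a + of_real b * i) = Complex a b" for a b
      by (simp add: f(1) f(2) fr i complex_eq_iff)
    show thesis
    proof (rule complex)
      show "i * i = - 1" by (rule inj) (simp add: f(2) i fm f1)
      show "\<exists>a b. c = of_real a + of_real b * i" for c
        using v[of "Re (f c)" "Im (f c)"] inj by (metis complex_surj)
      show "\<bar>a\<bar> \<le> norm (of_real a + of_real b * i)" for a b
        using f(3)[of "of_real a + of_real b * i"] abs_Re_le_cmod[of "Complex a b"] by (simp add: v)
    qed
  qed
qed

section \<open>Norming functionals over real or complex scalars\<close>

context normed_space_over
begin

lemma exists_norming_functional:
  obtains f where "f \<in> unit_functionals scale UNIV norm" "norm (f x0) = norm x0"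
proof -
  obtain h where h: "linear h" "\<forall>x. h x \<le> norm x" "h x0 = norm x0"
    using exists_real_norming_functional by blast
  have hs: "h (scale (of_real r) x) = r * h x" for r x
    using linear_scale[OF h(1)] by (simp add: scale_of_real)
  have ha: "\<bar>h x\<bar> \<le> norm x" for x
    using h(2)[rule_format, of x] h(2)[rule_format, of "- x"] linear_neg[OF h(1), of x] by simp
  show thesis
  proof (cases rule: real_or_complex_cases[where 'k='k])
    case real
    have "of_real (h (scale c x)) = c * of_real (h x)" for c x
    proof -
      obtain r where "c = of_real r" using real by blast
      then show ?thesis by (simp add: hs)
    qed
    then show thesis
      using h ha by (intro that[of "\<lambda>x. of_real (h x)"])
        (auto simp: unit_functionals_def linear_on_def linear_add)
  next
    case (complex i)
    \<comment> \<open>The usual complexification of a real functional, whose real part is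
      \<open>h\<close>.\<close>
    define F where "F x = of_real (h x) - of_real (h (scale i x)) * i" for x
    have add: "F (x + y) = F x + F y" for x y
      by (simp add: F_def linear_add[OF h(1)] scale_right_distrib algebra_simps)
    have i2: "scale i (scale i x) = - x" for x
      using complex(1) by (metis scale_scale scale_minus_left scale_one)
    have Fr: "F (scale (of_real r) x) = of_real r * F x" for r x
    proof -
      have "h (scale i (scale (of_real r) x)) = r * h (scale i x)"
        by (metis hs scale_left_commute)
      then show ?thesis by (simp add: F_def hs algebra_simps)
    qed
    have Fi: "F (scale i x) = i * F x" for x
    proof -
      have "i * F x = i * of_real (h x) - of_real (h (scale i x)) * (i * i)"
        by (simp add: F_def algebra_simps)
      then show ?thesis
        by (simp add: complex(1) F_def i2 linear_neg[OF h(1)] algebra_simps)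
    qed
    have scale: "F (scale c x) = c * F x" for c x
    proof -
      obtain a b where c: "c = of_real a + of_real b * i" using complex(2) by blast
      have "scale c x = scale (of_real a) x + scale (of_real b) (scale i x)"
        by (simp add: c scale_left_distrib)
      then have "F (scale c x) = of_real a * F x + of_real b * (i * F x)"
        by (simp only: add Fr Fi)
      then show ?thesis by (simp add: c algebra_simps)
    qed
    have le: "norm (F x) \<le> norm x" for x
    proof (cases "F x = 0")
      case False
      \<comment> \<open>Rotate \<open>x\<close> by a unimodular scalar that makes the value of
        \<open>F\<close> real and nonnegative; there \<open>F\<close> coincides with
        \<open>h\<close>, which is at most the norm.\<close>
      define c where "c = of_real (norm (F x)) / F x"
      have c1: "norm c = 1" using False by (simp add: c_def norm_divide)
      have "F (scale c x) = of_real (norm (F x))" using False by (simp add: scale c_def)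
      then have "of_real (h (scale c x) - norm (F x)) + of_real (- h (scale i (scale c x))) * i = 0"
        by (simp add: F_def algebra_simps)
      then have "\<bar>h (scale c x) - norm (F x)\<bar> \<le> 0" using complex(3) by (metis norm_zero)
      then show ?thesis using h(2)[rule_format, of "scale c x"] by (simp add: norm_scale c1)
    qed simp
    \<comment> \<open>The modulus of \<open>F x0\<close> dominates its real part
      \<open>h x0\<close>, which is already \<open>norm x0\<close>.\<close>
    have "norm x0 \<le> norm (F x0)"
      using complex(3)[of "h x0" "- h (scale i x0)"] by (simp add: F_def h(3))
    with le have "norm (F x0) = norm x0" by (simp add: antisym)
    then show thesis
      using add scale le by (intro that[of F]) (auto simp: unit_functionals_def linear_on_def)
  qed
qed

end

section \<open>Tensor products\<close>

lemma sum_fun_apply: "sum f A x = (\<Sum>a\<in>A. f a x)"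
  by (induction A rule: infinite_finite_induct) simp_all

interpretation tensor: vector_space "tensor_scale :: 'k::real_or_complex \<Rightarrow> ('k, 'l, 'e) tensor \<Rightarrow> _"
  by standard (simp_all add: tensor_scale_def fun_eq_iff algebra_simps)

lemma tensor_scale_apply [simp]: "tensor_scale c u B = c * u B"
  by (simp add: tensor_scale_def)

lemma linear_onI:
  assumes "\<And>x y. x \<in> V \<Longrightarrow> y \<in> V \<Longrightarrow> f (x + y) = f x + f y"
    and "\<And>c x. x \<in> V \<Longrightarrow> f (s1 c x) = s2 c (f x)"
  shows "linear_on s1 s2 V f"
  using assms by (simp add: linear_on_def)

lemma linear_on_add: "linear_on s1 s2 V f \<Longrightarrow> x \<in> V \<Longrightarrow> y \<in> V \<Longrightarrow> f (x + y) = f x + f y"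
  and linear_on_scale: "linear_on s1 s2 V f \<Longrightarrow> x \<in> V \<Longrightarrow> f (s1 c x) = s2 c (f x)"
  by (simp_all add: linear_on_def)

lemma linear_on_0:
  assumes "linear_on s1 s2 V f" "0 \<in> V"
  shows "f 0 = 0"
  using linear_on_add[OF assms assms(2)] by simp

lemma linear_on_comp:
  assumes "linear_on s1 s2 V f" "linear_on s2 s3 W g" "\<And>x. x \<in> V \<Longrightarrow> f x \<in> W"
  shows "linear_on s1 s3 V (\<lambda>x. g (f x))"
  using assms by (simp add: linear_on_def)

lemma linear_on_ident: "linear_on s s V (\<lambda>x. x)"
  by (simp add: linear_on_def)

lemma bounded_operators_linear_on: "a \<in> bounded_operators sL \<Longrightarrow> linear_on sL sL UNIV a"
  by (auto simp: bounded_operators_def linear_on_def linear_add bounded_linear.linear)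

lemma bilinear_forms_right: "B \<in> bilinear_forms sL E \<Longrightarrow> linear_on (scal E) (*) (carr E) (B \<xi>)"
  and bilinear_forms_left: "B \<in> bilinear_forms sL E \<Longrightarrow> x \<in> carr E \<Longrightarrow> linear_on sL (*) UNIV (\<lambda>\<xi>. B \<xi> x)"
  by (simp_all add: bilinear_forms_def)

lemma elem_tensor_add_left:
  "x \<in> carr E \<Longrightarrow> elem_tensor sL E (\<xi> + \<eta>) x = elem_tensor sL E \<xi> x + elem_tensor sL E \<eta> x"
  by (rule ext) (auto simp: elem_tensor_def linear_on_add[OF bilinear_forms_left])

lemma elem_tensor_scale_left:
  "x \<in> carr E \<Longrightarrow> elem_tensor sL E (sL c \<xi>) x = tensor_scale c (elem_tensor sL E \<xi> x)"
  by (rule ext) (auto simp: elem_tensor_def linear_on_scale[OF bilinear_forms_left])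

lemma elem_tensor_0_left: "x \<in> carr E \<Longrightarrow> elem_tensor sL E 0 x = 0"
  using elem_tensor_add_left[of x E sL 0 0] by simp

lemma elem_tensor_sum_left:
  "x \<in> carr E \<Longrightarrow> elem_tensor sL E (\<Sum>i\<in>A. \<xi> i) x = (\<Sum>i\<in>A. elem_tensor sL E (\<xi> i) x)"
  by (induction A rule: infinite_finite_induct) (auto simp: elem_tensor_0_left elem_tensor_add_left)

lemma elem_tensor_add_right:
  "x \<in> carr E \<Longrightarrow> y \<in> carr E \<Longrightarrow> elem_tensor sL E \<xi> (x + y) = elem_tensor sL E \<xi> x + elem_tensor sL E \<xi> y"
  by (rule ext) (auto simp: elem_tensor_def linear_on_add[OF bilinear_forms_right])

lemma elem_tensor_scale_right:
  "x \<in> carr E \<Longrightarrow> elem_tensor sL E \<xi> (scal E c x) = tensor_scale c (elem_tensor sL E \<xi> x)"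
  by (rule ext) (auto simp: elem_tensor_def linear_on_scale[OF bilinear_forms_right])

lemma elem_tensor_0_right: "0 \<in> carr E \<Longrightarrow> elem_tensor sL E \<xi> 0 = 0"
  using elem_tensor_add_right[of 0 E 0 sL \<xi>] by simp

text \<open>The purely algebraic half of \<open>is_lspace\<close>, separated because the tensor
  calculus is applied to direct sums and duals before their norms are known to be L-norms.\<close>

definition linear_lspace :: "('k::real_or_complex, 'l, 'e::ab_group_add) lspace \<Rightarrow> bool" where
  "linear_lspace E \<longleftrightarrow> vector_space (scal E) \<and> module.subspace (scal E) (carr E)"

lemma linear_lspaceD:
  assumes "linear_lspace E"
  shows carr_0: "0 \<in> carr E"
    and carr_add: "x \<in> carr E \<Longrightarrow> y \<in> carr E \<Longrightarrow> x + y \<in> carr E"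
    and carr_scal: "x \<in> carr E \<Longrightarrow> scal E c x \<in> carr E"
proof -
  interpret vector_space "scal E" using assms by (simp add: linear_lspace_def)
  have "subspace (carr E)" using assms by (simp add: linear_lspace_def)
  then show "0 \<in> carr E" "x \<in> carr E \<Longrightarrow> y \<in> carr E \<Longrightarrow> x + y \<in> carr E"
    "x \<in> carr E \<Longrightarrow> scal E c x \<in> carr E"
    by (simp_all add: subspace_0 subspace_add subspace_scale)
qed

lemma carr_sum:
  assumes "linear_lspace E" "\<And>i. i \<in> A \<Longrightarrow> x i \<in> carr E"
  shows "(\<Sum>i\<in>A. x i) \<in> carr E"
  using assms by (induction A rule: infinite_finite_induct) (auto simp: carr_0 carr_add)

lemma linear_on_sum:
  assumes f: "linear_on (scal E) s V f" and V: "linear_lspace E" "V = carr E"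
    and "\<And>i. i \<in> A \<Longrightarrow> x i \<in> V"
  shows "f (\<Sum>i\<in>A. x i) = (\<Sum>i\<in>A. f (x i))"
  using assms(4)
  by (induction A rule: infinite_finite_induct)
    (auto simp: linear_on_0[OF f] linear_on_add[OF f] V carr_0 carr_sum)

lemma elem_tensor_sum_right:
  assumes "linear_lspace E" "\<And>i. i \<in> A \<Longrightarrow> x i \<in> carr E"
  shows "elem_tensor sL E \<xi> (\<Sum>i\<in>A. x i) = (\<Sum>i\<in>A. elem_tensor sL E \<xi> (x i))"
  using assms
  by (induction A rule: infinite_finite_induct)
    (auto simp: elem_tensor_0_right elem_tensor_add_right carr_0 carr_sum)

lemma elem_tensor_in_tensor_space:
  "\<xi> \<in> S \<Longrightarrow> x \<in> carr E \<Longrightarrow> elem_tensor sL E \<xi> x \<in> tensor_space sL S E"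
  unfolding tensor_space_def by (rule tensor.span_base) blast

lemma subspace_tensor_space: "tensor.subspace (tensor_space sL S E)"
  unfolding tensor_space_def by (rule tensor.subspace_span)

lemmas tensor_space_0 = tensor.subspace_0[OF subspace_tensor_space]
  and tensor_space_add = tensor.subspace_add[OF subspace_tensor_space]
  and tensor_space_scale = tensor.subspace_scale[OF subspace_tensor_space]
  and tensor_space_sum = tensor.subspace_sum[OF subspace_tensor_space]

lemma tensor_space_mono: "S \<subseteq> T \<Longrightarrow> tensor_space sL S E \<subseteq> tensor_space sL T E"
  unfolding tensor_space_def by (rule tensor.span_mono) blast

lemma tensor_space_UNIV: "u \<in> tensor_space sL S E \<Longrightarrow> u \<in> tensor_space sL UNIV E"
  using tensor_space_mono[of S UNIV] by blast

lemma tensor_space_induct [consumes 1, case_names zero add scale elem]: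
  assumes "u \<in> tensor_space sL S E" and "P 0"
    and "\<And>u v. u \<in> tensor_space sL S E \<Longrightarrow> v \<in> tensor_space sL S E \<Longrightarrow> P u \<Longrightarrow> P v \<Longrightarrow> P (u + v)"
    and "\<And>c u. u \<in> tensor_space sL S E \<Longrightarrow> P u \<Longrightarrow> P (tensor_scale c u)"
    and "\<And>\<xi> x. \<xi> \<in> S \<Longrightarrow> x \<in> carr E \<Longrightarrow> P (elem_tensor sL E \<xi> x)"
  shows "P u"
proof -
  let ?A = "{elem_tensor sL E \<xi> x | \<xi> x. \<xi> \<in> S \<and> x \<in> carr E}"
  have "tensor.subspace {u. u \<in> tensor_space sL S E \<and> P u}"
    by (rule tensor.subspaceI)
      (auto simp: assms tensor_space_0 tensor_space_add tensor_space_scale)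
  then have "tensor.span ?A \<subseteq> {u. u \<in> tensor_space sL S E \<and> P u}"
    by (intro tensor.span_minimal) (auto simp: assms elem_tensor_in_tensor_space)
  then show ?thesis using assms(1) by (auto simp: tensor_space_def)
qed

text \<open>Thanks to this, the default value 0 in \<open>tensor_map\<close> is harmless: amplifying
  the identity gives back the tensor.\<close>

lemma tensor_vanishes:
  assumes "u \<in> tensor_space sL S E" "B \<notin> bilinear_forms sL E"
  shows "u B = 0"
  using assms by (induction rule: tensor_space_induct) (auto simp: elem_tensor_def)

section \<open>Tensor products of operators and linear maps\<close>

lemma tensor_map_add: "tensor_map sL E a \<phi> (u + v) = tensor_map sL E a \<phi> u + tensor_map sL E a \<phi> v"
  and tensor_map_scale: "tensor_map sL E a \<phi> (tensor_scale c u) = tensor_scale c (tensor_map sL E a \<phi> u)"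
  and tensor_map_0: "tensor_map sL E a \<phi> 0 = 0"
  by (rule ext; simp add: tensor_map_def)+

lemma tensor_map_sum: "tensor_map sL E a \<phi> (\<Sum>i\<in>A. u i) = (\<Sum>i\<in>A. tensor_map sL E a \<phi> (u i))"
  by (induction A rule: infinite_finite_induct)
    (simp_all only: sum.infinite sum.empty sum.insert tensor_map_0 tensor_map_add not_False_eq_True)

text \<open>Unlike in \<open>CC\<close>, members need be neither extensional nor contractive, so
  coordinate projections and injections qualify as they stand.\<close>

definition linear_maps :: "('k::real_or_complex, 'l, 'g::ab_group_add) lspace
    \<Rightarrow> ('k, 'l, 'e::ab_group_add) lspace \<Rightarrow> ('g \<Rightarrow> 'e) set" where
  "linear_maps G E = {\<phi>. linear_on (scal G) (scal E) (carr G) \<phi> \<and> \<phi> ` carr G \<subseteq> carr E}"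

lemma linear_maps_carr: "\<phi> \<in> linear_maps G E \<Longrightarrow> x \<in> carr G \<Longrightarrow> \<phi> x \<in> carr E"
  and linear_maps_linear: "\<phi> \<in> linear_maps G E \<Longrightarrow> linear_on (scal G) (scal E) (carr G) \<phi>"
  by (auto simp: linear_maps_def)

lemma linear_maps_ident: "(\<lambda>x. x) \<in> linear_maps E E"
  by (simp add: linear_maps_def linear_on_ident)

lemma bilinear_forms_comp:
  assumes "B \<in> bilinear_forms sL E" "linear_on sL sL UNIV a" "\<phi> \<in> linear_maps G E"
  shows "(\<lambda>\<xi> x. B (a \<xi>) (\<phi> x)) \<in> bilinear_forms sL G"
  using assms by (simp add: bilinear_forms_def linear_maps_def linear_on_def image_subset_iff)

lemma tensor_map_elem:
  assumes "linear_on sL sL UNIV a" "\<phi> \<in> linear_maps G E"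
  shows "tensor_map sL E a \<phi> (elem_tensor sL G \<xi> x) = elem_tensor sL E (a \<xi>) (\<phi> x)"
  using bilinear_forms_comp[OF _ assms] by (auto simp: tensor_map_def elem_tensor_def fun_eq_iff)

lemma tensor_map_comp:
  assumes "linear_on sL sL UNIV a" "\<phi> \<in> linear_maps G E"
  shows "tensor_map sL E a \<phi> (tensor_map sL G b \<psi> u) = tensor_map sL E (\<lambda>\<xi>. a (b \<xi>)) (\<lambda>x. \<phi> (\<psi> x)) u"
  using bilinear_forms_comp[OF _ assms] by (auto simp: tensor_map_def fun_eq_iff)

lemma tensor_map_ident:
  assumes "u \<in> tensor_space sL S E"
  shows "tensor_map sL E (\<lambda>\<xi>. \<xi>) (\<lambda>x. x) u = u"
  using tensor_vanishes[OF assms] by (auto simp: tensor_map_def fun_eq_iff)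

lemma tensor_map_in_tensor_space:
  assumes "u \<in> tensor_space sL S G" "linear_on sL sL UNIV a" "\<phi> \<in> linear_maps G E" "a ` S \<subseteq> T"
  shows "tensor_map sL E a \<phi> u \<in> tensor_space sL T E"
  using assms
  by (induction rule: tensor_space_induct)
    (auto simp: tensor_map_0 tensor_map_add tensor_map_scale tensor_map_elem tensor_space_0
      tensor_space_add tensor_space_scale elem_tensor_in_tensor_space linear_maps_carr)

text \<open>The form to which \<open>u\<close> is applied in \<open>tensor_map\<close> involves
  values of the maps off the carrier. These do not matter because \<open>u\<close> is a combination
  of evaluations at points of the carrier.\<close>

lemma tensor_map_cong:
  assumes "u \<in> tensor_space sL S G" "linear_on sL sL UNIV a" "\<phi> \<in> linear_maps G E" "\<psi> \<in> linear_maps G E"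
    and "\<And>x. x \<in> carr G \<Longrightarrow> \<phi> x = \<psi> x"
  shows "tensor_map sL E a \<phi> u = tensor_map sL E a \<psi> u"
  using assms
  by (induction rule: tensor_space_induct)
    (auto simp: tensor_map_0 tensor_map_add tensor_map_scale tensor_map_elem)

section \<open>L-norms and contractive morphisms\<close>

lemma is_lspace_linear: "is_lspace sL E \<Longrightarrow> linear_lspace E"
  by (simp add: is_lspace_def linear_lspace_def)

lemma lnorm_0: "is_lspace sL E \<Longrightarrow> lnorm E 0 = 0"
  by (simp add: is_lspace_def tensor_space_0)

lemma lnorm_nonneg: "is_lspace sL E \<Longrightarrow> u \<in> tensor_space sL UNIV E \<Longrightarrow> 0 \<le> lnorm E u"
  and lnorm_eq_0: "is_lspace sL E \<Longrightarrow> u \<in> tensor_space sL UNIV E \<Longrightarrow> lnorm E u = 0 \<longleftrightarrow> u = 0"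
  and lnorm_scale: "is_lspace sL E \<Longrightarrow> u \<in> tensor_space sL UNIV E \<Longrightarrow>
    lnorm E (tensor_scale c u) = norm c * lnorm E u"
  and lnorm_add: "is_lspace sL E \<Longrightarrow> u \<in> tensor_space sL UNIV E \<Longrightarrow> v \<in> tensor_space sL UNIV E \<Longrightarrow>
    lnorm E (u + v) \<le> lnorm E u + lnorm E v"
  and lnorm_act: "is_lspace sL E \<Longrightarrow> u \<in> tensor_space sL UNIV E \<Longrightarrow> a \<in> bounded_operators sL \<Longrightarrow>
    lnorm E (act sL E a u) \<le> onorm a * lnorm E u"
  by (simp_all add: is_lspace_def)

lemma lnorm_sum:
  assumes "is_lspace sL E" "\<And>i. i \<in> A \<Longrightarrow> u i \<in> tensor_space sL UNIV E"
  shows "lnorm E (\<Sum>i\<in>A. u i) \<le> (\<Sum>i\<in>A. lnorm E (u i))"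
  using assms(2)
proof (induction A rule: infinite_finite_induct)
  case (insert i A)
  then have "lnorm E (u i + (\<Sum>i\<in>A. u i)) \<le> lnorm E (u i) + lnorm E (\<Sum>i\<in>A. u i)"
    by (intro lnorm_add[OF assms(1)] tensor_space_sum) auto
  moreover have "lnorm E (\<Sum>i\<in>A. u i) \<le> (\<Sum>i\<in>A. lnorm E (u i))"
    using insert by auto
  ultimately show ?case unfolding sum.insert[OF insert(1,2)] by linarith
qed (simp_all only: sum.infinite sum.empty lnorm_0[OF assms(1)] order_refl not_False_eq_True)

lemma CC_iff:
  "\<phi> \<in> CC sL G E \<longleftrightarrow> \<phi> \<in> linear_maps G E \<and> \<phi> \<in> extensional (carr G) \<and>
    (\<forall>u\<in>tensor_space sL UNIV G. lnorm E (amplification sL E \<phi> u) \<le> lnorm G u)"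
  by (auto simp: CC_def linear_maps_def PiE_def)

lemma linear_maps_restrict:
  assumes "linear_lspace G" "\<phi> \<in> linear_maps G E"
  shows "restrict \<phi> (carr G) \<in> linear_maps G E"
  using assms by (auto simp: linear_maps_def linear_on_def carr_add carr_scal)

lemma linear_maps_comp:
  "\<phi> \<in> linear_maps G E \<Longrightarrow> \<psi> \<in> linear_maps F G \<Longrightarrow> (\<lambda>x. \<phi> (\<psi> x)) \<in> linear_maps F E"
  by (simp add: linear_maps_def linear_on_def image_subset_iff)

lemma amplification_restrict:
  assumes "linear_lspace G" "\<phi> \<in> linear_maps G E" "u \<in> tensor_space sL S G"
  shows "amplification sL E (restrict \<phi> (carr G)) u = amplification sL E \<phi> u"
  using linear_maps_restrict[OF assms(1,2)] assms(2,3)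
  by (intro tensor_map_cong[where G = G] linear_on_ident) auto

lemma restrict_in_CC:
  assumes "linear_lspace G" "\<phi> \<in> linear_maps G E"
    and "\<And>u. u \<in> tensor_space sL UNIV G \<Longrightarrow> lnorm E (amplification sL E \<phi> u) \<le> lnorm G u"
  shows "restrict \<phi> (carr G) \<in> CC sL G E"
  using assms by (simp add: CC_iff amplification_restrict linear_maps_restrict)

lemma amplification_comp:
  "\<phi> \<in> linear_maps G E \<Longrightarrow>
    amplification sL E \<phi> (amplification sL G \<psi> u) = amplification sL E (\<lambda>x. \<phi> (\<psi> x)) u"
  by (simp add: tensor_map_comp linear_on_ident)

lemma amplification_in_tensor_space:
  "u \<in> tensor_space sL S G \<Longrightarrow> \<phi> \<in> linear_maps G E \<Longrightarrow> amplification sL E \<phi> u \<in> tensor_space sL S E"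
  by (rule tensor_map_in_tensor_space) (auto simp: linear_on_ident)

lemma compose_in_CC:
  assumes "linear_lspace F" "\<phi> \<in> CC sL G E" "\<psi> \<in> CC sL F G"
  shows "compose (carr F) \<phi> \<psi> \<in> CC sL F E"
  unfolding compose_def
proof (rule restrict_in_CC)
  fix u assume u: "u \<in> tensor_space sL UNIV F"
  then have "amplification sL G \<psi> u \<in> tensor_space sL UNIV G"
    using assms(3) by (auto simp: CC_iff intro: amplification_in_tensor_space)
  then show "lnorm E (amplification sL E (\<lambda>x. \<phi> (\<psi> x)) u) \<le> lnorm F u"
    using assms u by (force simp: CC_iff simp flip: amplification_comp intro: order_trans)
qed (use assms in \<open>auto simp: CC_iff intro: linear_maps_comp\<close>)

lemma amplification_compose:
  assumes "linear_lspace F" "\<phi> \<in> CC sL G E" "\<psi> \<in> CC sL F G" "u \<in> tensor_space sL S F"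
  shows "amplification sL E (compose (carr F) \<phi> \<psi>) u = amplification sL E \<phi> (amplification sL G \<psi> u)"
proof -
  have "\<phi> \<in> linear_maps G E" "\<psi> \<in> linear_maps F G" using assms by (simp_all add: CC_iff)
  then show ?thesis
    using assms(1,4) unfolding compose_def
    by (simp add: amplification_comp amplification_restrict[OF _ linear_maps_comp])
qed

section \<open>Direct sums\<close>

lemma amplification_zero:
  assumes "linear_lspace E" "u \<in> tensor_space sL S G"
  shows "amplification sL E (\<lambda>x. 0) u = 0"
proof -
  have "(\<lambda>x. 0) \<in> linear_maps G E"
  proof -
    interpret vector_space "scal E" using assms(1) by (simp add: linear_lspace_def)
    show ?thesis by (auto simp: linear_maps_def linear_on_def carr_0[OF assms(1)])
  qed
  with assms(2) show ?thesis
    by (induction rule: tensor_space_induct)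
      (simp_all only: tensor_map_0 tensor_map_add tensor_map_scale tensor_map_elem linear_on_ident
        elem_tensor_0_right carr_0[OF assms(1)] add_0 tensor.scale_zero_right)
qed

definition coord_inj :: "'j \<Rightarrow> 'e \<Rightarrow> 'j \<Rightarrow> 'e::zero" where
  "coord_inj j x = (\<lambda>k. if k = j then x else 0)"

text \<open>The scalar multiplications are vector space structures at all indices, not only in
  \<open>J\<close>, because the ambient space of the direct sum consists of functions on the whole
  index type.\<close>

locale lspace_family =
  fixes sL :: "'k::real_or_complex \<Rightarrow> 'l::real_normed_vector \<Rightarrow> 'l" and J :: "'j set"
    and E :: "'j \<Rightarrow> ('k, 'l, 'e::ab_group_add) lspace"
  assumes vector_space_scal: "vector_space (scal (E j))"
    and is_lspace: "j \<in> J \<Longrightarrow> is_lspace sL (E j)"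
begin

abbreviation X :: "('k, 'l, 'j \<Rightarrow> 'e) lspace" where "X \<equiv> oplus1 sL J E"

abbreviation pr :: "'j \<Rightarrow> ('k, 'l, 'j \<Rightarrow> 'e) tensor \<Rightarrow> ('k, 'l, 'e) tensor" where
  "pr j \<equiv> amplification sL (E j) (\<lambda>x. x j)"

abbreviation inc :: "'j \<Rightarrow> ('k, 'l, 'e) tensor \<Rightarrow> ('k, 'l, 'j \<Rightarrow> 'e) tensor" where
  "inc j \<equiv> amplification sL X (coord_inj j)"

lemma linear_summand: "j \<in> J \<Longrightarrow> linear_lspace (E j)"
  by (rule is_lspace_linear[OF is_lspace])

lemma carr_oplus1:
  "carr X = {x. finite {j. x j \<noteq> 0} \<and> (\<forall>j\<in>J. x j \<in> carr (E j)) \<and> (\<forall>j. j \<notin> J \<longrightarrow> x j = 0)}"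
  by (simp add: oplus1_def)

lemma scal_oplus1: "scal X = (\<lambda>c x j. scal (E j) c (x j))"
  by (simp add: oplus1_def)

lemma scal_0: "scal (E j) c 0 = 0"
proof -
  interpret vector_space "scal (E j)" by (rule vector_space_scal)
  show ?thesis by simp
qed

lemma linear_lspace_oplus1: "linear_lspace X"
proof -
  have vs: "vector_space (scal X)"
  proof
    fix a b x y
    have "scal (E j) a (x j + y j) = scal (E j) a (x j) + scal (E j) a (y j)"
      "scal (E j) (a + b) (x j) = scal (E j) a (x j) + scal (E j) b (x j)"
      "scal (E j) a (scal (E j) b (x j)) = scal (E j) (a * b) (x j)"
      "scal (E j) 1 (x j) = x j" for j
      using vector_space_scal[of j] by (simp_all add: vector_space_def)
    then show "scal X a (x + y) = scal X a x + scal X a y"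
      "scal X (a + b) x = scal X a x + scal X b x"
      "scal X a (scal X b x) = scal X (a * b) x" "scal X 1 x = x"
      by (simp_all add: scal_oplus1 fun_eq_iff)
  qed
  interpret X: vector_space "scal X" by (rule vs)
  have "X.subspace (carr X)"
  proof (rule X.subspaceI)
    show "0 \<in> carr X" by (auto simp: carr_oplus1 carr_0[OF linear_summand])
  next
    fix x y assume xy: "x \<in> carr X" "y \<in> carr X"
    then have "finite ({j. x j \<noteq> 0} \<union> {j. y j \<noteq> 0})" by (simp add: carr_oplus1)
    then have "finite {j. x j + y j \<noteq> 0}" by (rule rev_finite_subset) auto
    with xy show "x + y \<in> carr X" by (auto simp: carr_oplus1 carr_add[OF linear_summand])
  next
    fix c x assume x: "x \<in> carr X"
    then have "finite {j. x j \<noteq> 0}" by (simp add: carr_oplus1)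
    then have "finite {j. scal X c x j \<noteq> 0}"
      by (rule rev_finite_subset) (auto simp: scal_oplus1 scal_0)
    with x show "scal X c x \<in> carr X"
      by (auto simp: carr_oplus1 scal_oplus1 scal_0 carr_scal[OF linear_summand])
  qed
  with vs show ?thesis by (simp add: linear_lspace_def)
qed

lemma coordinate_linear: "j \<in> J \<Longrightarrow> (\<lambda>x. x j) \<in> linear_maps X (E j)"
  by (auto simp: linear_maps_def linear_on_def carr_oplus1 scal_oplus1)

lemma coord_inj_linear: "j \<in> J \<Longrightarrow> coord_inj j \<in> linear_maps (E j) X"
  by (auto simp: linear_maps_def linear_on_def carr_oplus1 scal_oplus1 coord_inj_def fun_eq_iff
      scal_0 carr_0[OF linear_summand] intro: finite_subset[of _ "{j}"])

lemma carr_decomposition: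
  assumes "x \<in> carr X" "finite A" "{j. x j \<noteq> 0} \<subseteq> A"
  shows "x = (\<Sum>j\<in>A. coord_inj j (x j))"
  using assms by (auto simp: fun_eq_iff sum_fun_apply coord_inj_def)

lemma pr_in: "j \<in> J \<Longrightarrow> u \<in> tensor_space sL S X \<Longrightarrow> pr j u \<in> tensor_space sL S (E j)"
  by (rule amplification_in_tensor_space[OF _ coordinate_linear])

lemma inc_in: "j \<in> J \<Longrightarrow> v \<in> tensor_space sL S (E j) \<Longrightarrow> inc j v \<in> tensor_space sL S X"
  by (rule amplification_in_tensor_space[OF _ coord_inj_linear])

lemma pr_inc:
  assumes "j \<in> J" "k \<in> J" "v \<in> tensor_space sL S (E j)"
  shows "pr k (inc j v) = (if k = j then v else 0)"
proof -
  have "pr k (inc j v) = amplification sL (E k) (\<lambda>x. coord_inj j x k) v"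
    by (rule amplification_comp[OF coordinate_linear[OF assms(2)]])
  also have "\<dots> = (if k = j then v else 0)"
    using amplification_zero[OF linear_summand[OF assms(2)] assms(3)] tensor_map_ident[OF assms(3)]
    by (simp add: coord_inj_def)
  finally show ?thesis .
qed

text \<open>The decomposition is asserted for all sufficiently large finite index sets because this
  form survives addition, by uniting the two index sets. For an elementary tensor of
  \<open>\<xi>\<close> and \<open>x\<close>, the nonzero coordinates of \<open>x\<close>
  suffice.\<close>

lemma tensor_decomposition_eventually:
  assumes "u \<in> tensor_space sL UNIV X"
  shows "\<exists>A. finite A \<and> A \<subseteq> J \<and>
    (\<forall>A'. finite A' \<longrightarrow> A \<subseteq> A' \<longrightarrow> A' \<subseteq> J \<longrightarrow> u = (\<Sum>j\<in>A'. inc j (pr j u)))"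
  using assms
proof (induction rule: tensor_space_induct)
  case zero
  show ?case by (auto simp: tensor_map_0 simp del: func_zero intro!: exI[of _ "{}"] simp flip: zero_fun_def)
next
  case (add u v)
  then obtain A B where A: "finite A" "A \<subseteq> J"
    "\<And>A'. finite A' \<Longrightarrow> A \<subseteq> A' \<Longrightarrow> A' \<subseteq> J \<Longrightarrow> u = (\<Sum>j\<in>A'. inc j (pr j u))"
    and B: "finite B" "B \<subseteq> J"
    "\<And>A'. finite A' \<Longrightarrow> B \<subseteq> A' \<Longrightarrow> A' \<subseteq> J \<Longrightarrow> v = (\<Sum>j\<in>A'. inc j (pr j v))"
    by blast
  have "u + v = (\<Sum>j\<in>A'. inc j (pr j (u + v)))" if "finite A'" "A \<union> B \<subseteq> A'" "A' \<subseteq> J" for A'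
    using A(3)[of A'] B(3)[of A'] that by (simp only: tensor_map_add sum.distrib) auto
  moreover have "finite (A \<union> B)" "A \<union> B \<subseteq> J" using A B by auto
  ultimately show ?case by blast
next
  case (scale c u)
  then obtain A where A: "finite A" "A \<subseteq> J"
    "\<And>A'. finite A' \<Longrightarrow> A \<subseteq> A' \<Longrightarrow> A' \<subseteq> J \<Longrightarrow> u = (\<Sum>j\<in>A'. inc j (pr j u))"
    by blast
  have "tensor_scale c u = (\<Sum>j\<in>A'. inc j (pr j (tensor_scale c u)))"
    if "finite A'" "A \<subseteq> A'" "A' \<subseteq> J" for A'
    using A(3)[OF that] by (simp only: tensor_map_scale flip: tensor.scale_sum_right)
  then show ?case using A by blast
next
  case (elem \<xi> x)
  let ?A = "{j. x j \<noteq> 0}"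
  have "finite ?A" "?A \<subseteq> J" using elem by (auto simp: carr_oplus1)
  moreover have "elem_tensor sL X \<xi> x = (\<Sum>j\<in>A'. inc j (pr j (elem_tensor sL X \<xi> x)))"
    if A': "finite A'" "?A \<subseteq> A'" "A' \<subseteq> J" for A'
  proof -
    have "inc j (pr j (elem_tensor sL X \<xi> x)) = elem_tensor sL X \<xi> (coord_inj j (x j))"
      if "j \<in> A'" for j
      using that A'(3) by (auto simp: tensor_map_elem[OF linear_on_ident coordinate_linear]
          tensor_map_elem[OF linear_on_ident coord_inj_linear])
    moreover have "elem_tensor sL X \<xi> (\<Sum>j\<in>A'. coord_inj j (x j)) =
        (\<Sum>j\<in>A'. elem_tensor sL X \<xi> (coord_inj j (x j)))"
      using A'(3) elem by (intro elem_tensor_sum_right[OF linear_lspace_oplus1])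
        (auto intro!: linear_maps_carr[OF coord_inj_linear] linear_maps_carr[OF coordinate_linear])
    ultimately show ?thesis
      using carr_decomposition[OF elem(2) A'(1,2)] by (metis (no_types, lifting) sum.cong)
  qed
  ultimately show ?case by blast
qed

text \<open>Applying \<open>pr k\<close> to a decomposition over \<open>A\<close> shows that the
  components outside \<open>A\<close> vanish, so the support is finite. Terms outside the support
  contribute nothing, hence any finite index set containing it serves.\<close>

lemma tensor_decomposition:
  assumes u: "u \<in> tensor_space sL UNIV X"
  shows finite_support: "finite {j \<in> J. pr j u \<noteq> 0}"
    and decomposition: "\<And>A. finite A \<Longrightarrow> {j \<in> J. pr j u \<noteq> 0} \<subseteq> A \<Longrightarrow> A \<subseteq> J \<Longrightarrow>
      u = (\<Sum>j\<in>A. inc j (pr j u))"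
proof -
  obtain A where A: "finite A" "A \<subseteq> J"
    "\<And>A'. finite A' \<Longrightarrow> A \<subseteq> A' \<Longrightarrow> A' \<subseteq> J \<Longrightarrow> u = (\<Sum>j\<in>A'. inc j (pr j u))"
    using tensor_decomposition_eventually[OF u] by blast
  have "pr k u = 0" if "k \<in> J - A" for k
  proof -
    have "pr k u = pr k (\<Sum>j\<in>A. inc j (pr j u))" using A by simp
    also have "\<dots> = (\<Sum>j\<in>A. pr k (inc j (pr j u)))" by (rule tensor_map_sum)
    also have "\<dots> = 0"
    proof (rule sum.neutral, rule ballI)
      fix j assume "j \<in> A"
      then show "pr k (inc j (pr j u)) = 0"
        using that A(2) pr_inc[of j k, OF _ _ pr_in[OF _ u]] by auto
    qed
    finally show ?thesis .
  qed
  then have sub: "{j \<in> J. pr j u \<noteq> 0} \<subseteq> A" by blast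
  then show "finite {j \<in> J. pr j u \<noteq> 0}" using A(1) finite_subset by blast
  fix A' assume A': "finite A'" "{j \<in> J. pr j u \<noteq> 0} \<subseteq> A'" "A' \<subseteq> J"
  have "u = (\<Sum>j\<in>A \<union> A'. inc j (pr j u))" using A A' by (intro A(3)) auto
  also have "\<dots> = (\<Sum>j\<in>A'. inc j (pr j u))"
  proof (rule sum.mono_neutral_right)
    show "\<forall>j\<in>A \<union> A' - A'. inc j (pr j u) = 0"
    proof
      fix j assume "j \<in> A \<union> A' - A'"
      then have "pr j u = 0" using A' A(2) by blast
      then show "inc j (pr j u) = 0" by (simp only: tensor_map_0)
    qed
  qed (use A A' in auto)
  finally show "u = (\<Sum>j\<in>A'. inc j (pr j u))" .
qed

text \<open>The freedom in the choice of \<open>A\<close> allows the norms of several tensors to be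
  compared over a common index set.\<close>

lemma lnorm_oplus1:
  assumes "u \<in> tensor_space sL UNIV X" "finite A" "{j \<in> J. pr j u \<noteq> 0} \<subseteq> A" "A \<subseteq> J"
  shows "lnorm X u = (\<Sum>j\<in>A. lnorm (E j) (pr j u))"
proof -
  have "lnorm X u = (\<Sum>j | j \<in> J \<and> pr j u \<noteq> 0. lnorm (E j) (pr j u))"
    by (simp add: oplus1_def)
  also have "\<dots> = (\<Sum>j\<in>A. lnorm (E j) (pr j u))"
  proof (rule sum.mono_neutral_left)
    show "\<forall>j\<in>A - {j \<in> J. pr j u \<noteq> 0}. lnorm (E j) (pr j u) = 0"
    proof
      fix j assume "j \<in> A - {j \<in> J. pr j u \<noteq> 0}"
      then have "j \<in> J" "pr j u = 0" using assms(4) by auto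
      then show "lnorm (E j) (pr j u) = 0" by (simp only: lnorm_0[OF is_lspace])
    qed
  qed (use assms in auto)
  finally show ?thesis .
qed

lemma is_lspace_oplus1: "is_lspace sL X"
  unfolding is_lspace_def
proof (intro conjI ballI allI)
  show "vector_space (scal X)" "module.subspace (scal X) (carr X)"
    using linear_lspace_oplus1 by (simp_all add: linear_lspace_def)
next
  fix u assume u: "u \<in> tensor_space sL UNIV X"
  let ?A = "{j \<in> J. pr j u \<noteq> 0}"
  have fin: "finite ?A" by (rule finite_support[OF u])
  have n: "lnorm X u = (\<Sum>j\<in>?A. lnorm (E j) (pr j u))"
    by (rule lnorm_oplus1[OF u fin]) auto
  show "0 \<le> lnorm X u"
    unfolding n by (intro sum_nonneg) (auto intro: lnorm_nonneg[OF is_lspace] pr_in[OF _ u])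
  show "(lnorm X u = 0) = (u = 0)"
  proof
    assume "lnorm X u = 0"
    then have "\<forall>j\<in>?A. lnorm (E j) (pr j u) = 0"
      unfolding n using fin by (subst (asm) sum_nonneg_eq_0_iff)
        (auto intro: lnorm_nonneg[OF is_lspace] pr_in[OF _ u])
    then have "?A = {}"
      using lnorm_eq_0[OF is_lspace pr_in[OF _ u]] by blast
    then have "u = (\<Sum>j\<in>{}. inc j (pr j u))"
      by (intro decomposition[OF u]) auto
    then show "u = 0" by (simp only: sum.empty)
  next
    assume "u = 0"
    then show "lnorm X u = 0" unfolding n by (simp only: tensor_map_0) simp
  qed
next
  fix u c assume u: "u \<in> tensor_space sL UNIV X"
  let ?A = "{j \<in> J. pr j u \<noteq> 0}"
  have fin: "finite ?A" by (rule finite_support[OF u])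
  have "lnorm X (tensor_scale c u) = (\<Sum>j\<in>?A. lnorm (E j) (pr j (tensor_scale c u)))"
  proof (rule lnorm_oplus1[OF tensor_space_scale[OF u] fin])
    show "{j \<in> J. pr j (tensor_scale c u) \<noteq> 0} \<subseteq> ?A"
      by (auto simp only: tensor_map_scale tensor.scale_zero_right)
  qed auto
  also have "\<dots> = (\<Sum>j\<in>?A. norm c * lnorm (E j) (pr j u))"
    by (intro sum.cong refl) (simp add: tensor_map_scale lnorm_scale[OF is_lspace pr_in[OF _ u]])
  also have "\<dots> = norm c * lnorm X u"
    by (subst lnorm_oplus1[OF u fin]) (auto simp: sum_distrib_left)
  finally show "lnorm X (tensor_scale c u) = norm c * lnorm X u" .
next
  fix u v assume u: "u \<in> tensor_space sL UNIV X" and v: "v \<in> tensor_space sL UNIV X"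
  let ?A = "{j \<in> J. pr j u \<noteq> 0} \<union> {j \<in> J. pr j v \<noteq> 0}"
  have fin: "finite ?A" using finite_support[OF u] finite_support[OF v] by blast
  have "lnorm X (u + v) = (\<Sum>j\<in>?A. lnorm (E j) (pr j (u + v)))"
  proof (rule lnorm_oplus1[OF tensor_space_add[OF u v] fin])
    show "{j \<in> J. pr j (u + v) \<noteq> 0} \<subseteq> ?A"
      by (auto simp only: tensor_map_add add_0)
  qed auto
  also have "\<dots> \<le> (\<Sum>j\<in>?A. lnorm (E j) (pr j u) + lnorm (E j) (pr j v))"
    unfolding tensor_map_add
    by (intro sum_mono lnorm_add[OF is_lspace] pr_in u v) auto
  also have "\<dots> = lnorm X u + lnorm X v"
    by (subst (1 2) lnorm_oplus1[OF _ fin]) (auto simp: u v sum.distrib)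
  finally show "lnorm X (u + v) \<le> lnorm X u + lnorm X v" .
next
  fix a u assume a: "a \<in> bounded_operators sL" and u: "u \<in> tensor_space sL UNIV X"
  let ?A = "{j \<in> J. pr j u \<noteq> 0}"
  have fin: "finite ?A" by (rule finite_support[OF u])
  have lin: "linear_on sL sL UNIV a" by (rule bounded_operators_linear_on[OF a])
  have au: "act sL X a u \<in> tensor_space sL UNIV X"
    by (rule tensor_map_in_tensor_space[OF u lin linear_maps_ident]) simp
  \<comment> \<open>An operator on the factor \<open>L\<close> commutes with the projections to the
    summands, so it acts on each component separately.\<close>
  have pr: "pr j (act sL X a u) = act sL (E j) a (pr j u)" if "j \<in> J" for j
    by (simp only: tensor_map_comp[OF linear_on_ident coordinate_linear[OF that]]
        tensor_map_comp[OF lin linear_maps_ident])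
  have "lnorm X (act sL X a u) = (\<Sum>j\<in>?A. lnorm (E j) (pr j (act sL X a u)))"
  proof (rule lnorm_oplus1[OF au fin])
    show "{j \<in> J. pr j (act sL X a u) \<noteq> 0} \<subseteq> ?A"
      using pr by (auto simp only: tensor_map_0)
  qed auto
  also have "\<dots> \<le> (\<Sum>j\<in>?A. onorm a * lnorm (E j) (pr j u))"
    by (intro sum_mono) (auto simp: pr intro!: lnorm_act[OF is_lspace] pr_in u a)
  also have "\<dots> = onorm a * lnorm X u"
    by (subst lnorm_oplus1[OF u fin]) (auto simp: sum_distrib_left)
  finally show "lnorm X (act sL X a u) \<le> onorm a * lnorm X u" .
qed

lemma lnorm_inc:
  assumes "j \<in> J" "v \<in> tensor_space sL UNIV (E j)"
  shows "lnorm X (inc j v) = lnorm (E j) v"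
proof -
  have "lnorm X (inc j v) = (\<Sum>k\<in>{j}. lnorm (E k) (pr k (inc j v)))"
    using assms(1) by (intro lnorm_oplus1 inc_in assms) (auto simp: pr_inc[OF _ _ assms(2)])
  then show ?thesis using pr_inc[OF assms(1,1,2)] by simp
qed

end

section \<open>Universal tensors\<close>

text \<open>The test space \<open>E\<close> is a parameter, since passing to a direct sum preserves
  universality for each test space separately.\<close>

definition universal_tensors ::
    "('k::real_or_complex \<Rightarrow> 'l::real_normed_vector \<Rightarrow> 'l) \<Rightarrow> ('k, 'l, 'f::ab_group_add) lspace
      \<Rightarrow> 'j set \<Rightarrow> ('j \<Rightarrow> 'l set) \<Rightarrow> ('j \<Rightarrow> ('k, 'l, 'f) tensor)
      \<Rightarrow> ('k, 'l, 'e::ab_group_add) lspace \<Rightarrow> bool" where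
  "universal_tensors sL F K S w E \<longleftrightarrow>
     (\<forall>j\<in>K. w j \<in> tensor_space sL (S j) F \<and> lnorm F (w j) \<le> 1) \<and>
     (\<forall>v. (\<forall>j\<in>K. v j \<in> tensor_space sL (S j) E \<and> lnorm E (v j) \<le> 1) \<longrightarrow>
        (\<exists>!\<phi>. \<phi> \<in> CC sL F E \<and> (\<forall>j\<in>K. amplification sL E \<phi> (w j) = v j)))"

text \<open>Adjusts the product index sets that arise from direct sums: singleton factors can be
  removed or added.\<close>

lemma universal_tensors_reindex:
  assumes w: "universal_tensors sL F K S w E" and h: "bij_betw h K' K"
  shows "universal_tensors sL F K' (S \<circ> h) (w \<circ> h) E"
  unfolding universal_tensors_def
proof (intro conjI allI impI ballI)
  fix j assume "j \<in> K'"
  then have "h j \<in> K" using h by (rule bij_betwE[rule_format, rotated])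
  then show "(w \<circ> h) j \<in> tensor_space sL ((S \<circ> h) j) F" "lnorm F ((w \<circ> h) j) \<le> 1"
    using w by (auto simp: universal_tensors_def)
next
  fix v assume v: "\<forall>j\<in>K'. v j \<in> tensor_space sL ((S \<circ> h) j) E \<and> lnorm E (v j) \<le> 1"
  \<comment> \<open>A family indexed by \<open>K'\<close> is moved to \<open>K\<close> along the
    inverse of \<open>h\<close>.\<close>
  let ?g = "inv_into K' h"
  have g: "?g j \<in> K'" "h (?g j) = j" if "j \<in> K" for j
    using bij_betwE[OF bij_betw_inv_into[OF h]] bij_betw_inv_into_right[OF h] that by auto
  have "\<exists>!\<phi>. \<phi> \<in> CC sL F E \<and> (\<forall>j\<in>K. amplification sL E \<phi> (w j) = v (?g j))"
  proof -
    have "v (?g j) \<in> tensor_space sL (S j) E \<and> lnorm E (v (?g j)) \<le> 1" if "j \<in> K" for j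
      using v[rule_format, OF g(1)[OF that]] g(2)[OF that] by simp
    then show ?thesis
      using w[unfolded universal_tensors_def, THEN conjunct2, rule_format, of "\<lambda>j. v (?g j)"] by blast
  qed
  moreover have "(\<forall>j\<in>K. amplification sL E \<phi> (w j) = v (?g j)) \<longleftrightarrow>
      (\<forall>j\<in>K'. amplification sL E \<phi> ((w \<circ> h) j) = v j)" for \<phi>
  proof (intro iffI ballI)
    fix j assume *: "\<forall>j\<in>K. amplification sL E \<phi> (w j) = v (?g j)" and j: "j \<in> K'"
    then show "amplification sL E \<phi> ((w \<circ> h) j) = v j"
      using *[rule_format, of "h j"] bij_betwE[OF h] bij_betw_inv_into_left[OF h j] by simp
  next
    fix j assume *: "\<forall>j\<in>K'. amplification sL E \<phi> ((w \<circ> h) j) = v j" and j: "j \<in> K"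
    then show "amplification sL E \<phi> (w j) = v (?g j)"
      using *[rule_format, OF g(1)[OF j]] g(2)[OF j] by simp
  qed
  ultimately show "\<exists>!\<phi>. \<phi> \<in> CC sL F E \<and> (\<forall>j\<in>K'. amplification sL E \<phi> ((w \<circ> h) j) = v j)"
    by simp
qed

section \<open>Universal tensors of a direct sum\<close>

context lspace_family
begin

text \<open>Contractivity is inherited because the injection of a summand is isometric on
  tensors.\<close>

lemma CC_comp_coord_inj:
  assumes "\<phi> \<in> CC sL X G" "j \<in> J"
  shows "restrict (\<lambda>x. \<phi> (coord_inj j x)) (carr (E j)) \<in> CC sL (E j) G"
proof (rule restrict_in_CC)
  have \<phi>: "\<phi> \<in> linear_maps X G" using assms(1) by (simp add: CC_iff)
  show "(\<lambda>x. \<phi> (coord_inj j x)) \<in> linear_maps (E j) G"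
    by (rule linear_maps_comp[OF \<phi> coord_inj_linear[OF assms(2)]])
  fix v assume v: "v \<in> tensor_space sL UNIV (E j)"
  have "lnorm G (amplification sL G \<phi> (inc j v)) \<le> lnorm X (inc j v)"
    using assms inc_in[OF assms(2) v] by (simp add: CC_iff)
  then show "lnorm G (amplification sL G (\<lambda>x. \<phi> (coord_inj j x)) v) \<le> lnorm (E j) v"
    by (simp only: amplification_comp[OF \<phi>] lnorm_inc[OF assms(2) v])
qed (rule linear_summand[OF assms(2)])

lemma amplification_inc:
  assumes "\<phi> \<in> linear_maps X G" "j \<in> J" "v \<in> tensor_space sL S (E j)"
  shows "amplification sL G \<phi> (inc j v) =
    amplification sL G (restrict (\<lambda>x. \<phi> (coord_inj j x)) (carr (E j))) v"
  by (simp only: amplification_comp[OF assms(1)] amplification_restrict[OF linear_summand[OF assms(2)]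
        linear_maps_comp[OF assms(1) coord_inj_linear[OF assms(2)]] assms(3)])

lemma CC_oplus1_eqI:
  assumes \<phi>: "\<phi> \<in> CC sL X G" and \<psi>: "\<psi> \<in> CC sL X G" and G: "linear_lspace G"
    and eq: "\<And>j x. j \<in> J \<Longrightarrow> x \<in> carr (E j) \<Longrightarrow> \<phi> (coord_inj j x) = \<psi> (coord_inj j x)"
  shows "\<phi> = \<psi>"
proof (rule extensionalityI[of _ "carr X"])
  show "\<phi> \<in> extensional (carr X)" "\<psi> \<in> extensional (carr X)"
    using \<phi> \<psi> by (simp_all add: CC_iff)
  fix x assume x: "x \<in> carr X"
  let ?A = "{j. x j \<noteq> 0}"
  have A: "finite ?A" "\<And>j. j \<in> ?A \<Longrightarrow> j \<in> J" "\<And>j. j \<in> ?A \<Longrightarrow> x j \<in> carr (E j)"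
    using x by (auto simp: carr_oplus1)
  have "\<chi> x = (\<Sum>j\<in>?A. \<chi> (coord_inj j (x j)))" if "\<chi> \<in> CC sL X G" for \<chi>
  proof -
    have lin: "linear_on (scal X) (scal G) (carr X) \<chi>" using that by (simp add: CC_iff linear_maps_def)
    have "\<chi> x = \<chi> (\<Sum>j\<in>?A. coord_inj j (x j))"
      using carr_decomposition[OF x A(1) subset_refl] by (rule arg_cong)
    also have "\<dots> = (\<Sum>j\<in>?A. \<chi> (coord_inj j (x j)))"
      using A by (intro linear_on_sum[OF lin linear_lspace_oplus1 refl])
        (rule linear_maps_carr[OF coord_inj_linear])
    finally show ?thesis .
  qed
  moreover have "(\<Sum>j\<in>?A. \<phi> (coord_inj j (x j))) = (\<Sum>j\<in>?A. \<psi> (coord_inj j (x j)))"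
    using A by (intro sum.cong refl eq)
  ultimately show "\<phi> x = \<psi> x" using \<phi> \<psi> by simp
qed

text \<open>Together with \<open>CC_oplus1_eqI\<close> this makes the direct sum a coproduct. The
  sum norm is the right one for it: the triangle inequality bounds the image of \<open>u\<close> by
  the sum of the norms of its components.\<close>

lemma CC_oplus1_exists:
  assumes G: "is_lspace sL G" and \<phi>: "\<And>j. j \<in> J \<Longrightarrow> \<phi> j \<in> CC sL (E j) G"
  obtains \<psi> where "\<psi> \<in> CC sL X G" "\<forall>j\<in>J. restrict (\<lambda>x. \<psi> (coord_inj j x)) (carr (E j)) = \<phi> j"
proof -
  note linG = is_lspace_linear[OF G]
  have lin: "\<phi> j \<in> linear_maps (E j) G" if "j \<in> J" for j
    using \<phi>[OF that] by (simp add: CC_iff)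
  have \<phi>0: "\<phi> j 0 = 0" if "j \<in> J" for j
    by (rule linear_on_0[OF linear_maps_linear[OF lin[OF that]] carr_0[OF linear_summand[OF that]]])
  define \<psi> where "\<psi> x = (\<Sum>j | x j \<noteq> 0. \<phi> j (x j))" for x
  \<comment> \<open>Sums for different vectors can be taken over a common finite set, since each
    \<open>\<phi> j\<close> sends a vanishing coordinate to 0.\<close>
  have \<psi>_eq: "\<psi> x = (\<Sum>j\<in>A. \<phi> j (x j))" if "finite A" "{j. x j \<noteq> 0} \<subseteq> A" "A \<subseteq> J" for x A
    unfolding \<psi>_def using that \<phi>0 by (intro sum.mono_neutral_left) auto
  have fin: "finite {j. x j \<noteq> 0}" "{j. x j \<noteq> 0} \<subseteq> J" if "x \<in> carr X" for x
    using that by (auto simp: carr_oplus1)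
  have x_in: "x j \<in> carr (E j)" if "x \<in> carr X" "j \<in> J" for x j
    using that by (auto simp: carr_oplus1)
  interpret G: vector_space "scal G" using linG by (simp add: linear_lspace_def)
  have \<psi>_lin: "\<psi> \<in> linear_maps X G"
    unfolding linear_maps_def
  proof (intro CollectI conjI linear_onI subsetI)
    fix x y assume x: "x \<in> carr X" and y: "y \<in> carr X"
    let ?A = "{j. x j \<noteq> 0} \<union> {j. y j \<noteq> 0}"
    have A: "finite ?A" "?A \<subseteq> J" using fin[OF x] fin[OF y] by auto
    have "{j. (x + y) j \<noteq> 0} \<subseteq> ?A" by auto
    then have "\<psi> (x + y) = (\<Sum>j\<in>?A. \<phi> j (x j + y j))"
      using \<psi>_eq[OF A(1) _ A(2), of "x + y"] by simp
    also have "\<dots> = (\<Sum>j\<in>?A. \<phi> j (x j) + \<phi> j (y j))"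
    proof (rule sum.cong[OF refl])
      fix j assume "j \<in> ?A"
      then have j: "j \<in> J" using A(2) by blast
      show "\<phi> j (x j + y j) = \<phi> j (x j) + \<phi> j (y j)"
        by (rule linear_on_add[OF linear_maps_linear[OF lin[OF j]] x_in[OF x j] x_in[OF y j]])
    qed
    also have "\<dots> = \<psi> x + \<psi> y"
      using \<psi>_eq[OF A(1) _ A(2), of x] \<psi>_eq[OF A(1) _ A(2), of y] by (simp add: sum.distrib)
    finally show "\<psi> (x + y) = \<psi> x + \<psi> y" .
  next
    fix c x assume x: "x \<in> carr X"
    let ?A = "{j. x j \<noteq> 0}"
    have "{j. scal X c x j \<noteq> 0} \<subseteq> ?A" by (auto simp: scal_oplus1 scal_0)
    then have "\<psi> (scal X c x) = (\<Sum>j\<in>?A. \<phi> j (scal (E j) c (x j)))"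
      using \<psi>_eq[OF fin(1)[OF x] _ fin(2)[OF x], of "scal X c x"] by (simp add: scal_oplus1)
    also have "\<dots> = (\<Sum>j\<in>?A. scal G c (\<phi> j (x j)))"
    proof (rule sum.cong[OF refl])
      fix j assume "j \<in> ?A"
      then have j: "j \<in> J" using fin(2)[OF x] by blast
      show "\<phi> j (scal (E j) c (x j)) = scal G c (\<phi> j (x j))"
        by (rule linear_on_scale[OF linear_maps_linear[OF lin[OF j]] x_in[OF x j]])
    qed
    finally show "\<psi> (scal X c x) = scal G c (\<psi> x)"
      by (simp add: \<psi>_def G.scale_sum_right)
  next
    fix y assume "y \<in> \<psi> ` carr X"
    then obtain x where x: "x \<in> carr X" "y = \<psi> x" by blast
    show "y \<in> carr G"
      unfolding x(2) \<psi>_def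
    proof (rule carr_sum[OF linG])
      fix j assume "j \<in> {j. x j \<noteq> 0}"
      then have j: "j \<in> J" using fin(2)[OF x(1)] by blast
      show "\<phi> j (x j) \<in> carr G" by (rule linear_maps_carr[OF lin[OF j] x_in[OF x(1) j]])
    qed
  qed
  have \<psi>_inj: "\<psi> (coord_inj j x) = \<phi> j x" if "j \<in> J" for j x
  proof -
    have "{k. coord_inj j x k \<noteq> 0} \<subseteq> {j}" by (auto simp: coord_inj_def)
    then show ?thesis using \<psi>_eq[of "{j}" "coord_inj j x"] that by (simp add: coord_inj_def)
  qed
  have restr: "restrict (\<lambda>x. \<psi> (coord_inj j x)) (carr (E j)) = \<phi> j" if "j \<in> J" for j
    using \<phi>[OF that] by (simp add: \<psi>_inj[OF that] CC_iff extensional_restrict)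
  have le: "lnorm G (amplification sL G \<psi> u) \<le> lnorm X u" if u: "u \<in> tensor_space sL UNIV X" for u
  proof -
    let ?A = "{j \<in> J. pr j u \<noteq> 0}"
    have A: "finite ?A" "?A \<subseteq> J" using finite_support[OF u] by auto
    have "amplification sL G \<psi> u = amplification sL G \<psi> (\<Sum>j\<in>?A. inc j (pr j u))"
      using decomposition[OF u A(1) subset_refl A(2)] by (rule arg_cong)
    also have "\<dots> = (\<Sum>j\<in>?A. amplification sL G (\<phi> j) (pr j u))"
      unfolding tensor_map_sum
    proof (intro sum.cong refl)
      fix j assume "j \<in> ?A"
      then have j: "j \<in> J" by simp
      show "amplification sL G \<psi> (inc j (pr j u)) = amplification sL G (\<phi> j) (pr j u)"
        by (simp only: amplification_inc[OF \<psi>_lin j pr_in[OF j u]] restr[OF j])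
    qed
    finally have "lnorm G (amplification sL G \<psi> u) \<le> (\<Sum>j\<in>?A. lnorm G (amplification sL G (\<phi> j) (pr j u)))"
      using lnorm_sum[OF G, of ?A "\<lambda>j. amplification sL G (\<phi> j) (pr j u)"]
        amplification_in_tensor_space[OF pr_in[OF _ u] lin] by simp
    also have "\<dots> \<le> (\<Sum>j\<in>?A. lnorm (E j) (pr j u))"
      using \<phi> pr_in[OF _ u] by (intro sum_mono) (auto simp: CC_iff)
    also have "\<dots> = lnorm X u"
      using lnorm_oplus1[OF u A(1) subset_refl A(2)] by simp
    finally show ?thesis .
  qed
  show thesis
  proof (rule that)
    show "restrict \<psi> (carr X) \<in> CC sL X G"
      by (rule restrict_in_CC[OF linear_lspace_oplus1 \<psi>_lin le])
    have "coord_inj j x \<in> carr X" if "j \<in> J" "x \<in> carr (E j)" for j x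
      by (rule linear_maps_carr[OF coord_inj_linear[OF that(1)] that(2)])
    then show "\<forall>j\<in>J. restrict (\<lambda>x. restrict \<psi> (carr X) (coord_inj j x)) (carr (E j)) = \<phi> j"
      using restr by (metis (no_types, lifting) restrict_apply' restrict_ext)
  qed
qed

text \<open>A morphism on the sum amounts to a family of morphisms on the summands, and its
  amplification at \<open>inc j (w j k)\<close> is that of its component \<open>j\<close> at
  \<open>w j k\<close>. Hence existence and uniqueness hold summand by summand.\<close>

lemma universal_tensors_oplus1:
  assumes G: "is_lspace sL G" and w: "\<And>j. j \<in> J \<Longrightarrow> universal_tensors sL (E j) (K j) (S j) (w j) G"
  shows "universal_tensors sL X (Sigma J K) (\<lambda>(j, k). S j k) (\<lambda>(j, k). inc j (w j k)) G"
proof -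
  have w_in: "w j k \<in> tensor_space sL (S j k) (E j)" "lnorm (E j) (w j k) \<le> 1" if "j \<in> J" "k \<in> K j" for j k
    using w[OF that(1)] that(2) by (auto simp: universal_tensors_def)
  have amp: "amplification sL G \<phi> (inc j (w j k)) =
      amplification sL G (restrict (\<lambda>x. \<phi> (coord_inj j x)) (carr (E j))) (w j k)"
    if "\<phi> \<in> CC sL X G" "j \<in> J" "k \<in> K j" for \<phi> j k
    using that w_in[OF that(2,3)] by (intro amplification_inc) (auto simp: CC_iff)
  show ?thesis
    unfolding universal_tensors_def
  proof (intro conjI ballI allI impI)
    fix p assume "p \<in> Sigma J K"
    then obtain j k where p: "p = (j, k)" "j \<in> J" "k \<in> K j" by auto
    show "(case p of (j, k) \<Rightarrow> inc j (w j k)) \<in> tensor_space sL (case p of (j, k) \<Rightarrow> S j k) X"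
      using inc_in[OF p(2) w_in(1)[OF p(2,3)]] by (simp add: p(1))
    show "lnorm X (case p of (j, k) \<Rightarrow> inc j (w j k)) \<le> 1"
      using lnorm_inc[OF p(2) tensor_space_UNIV[OF w_in(1)[OF p(2,3)]]] w_in(2)[OF p(2,3)]
      by (simp add: p(1))
  next
    fix v assume v: "\<forall>p\<in>Sigma J K. v p \<in> tensor_space sL (case p of (j, k) \<Rightarrow> S j k) G \<and> lnorm G (v p) \<le> 1"
    have unique: "\<exists>!\<phi>. \<phi> \<in> CC sL (E j) G \<and> (\<forall>k\<in>K j. amplification sL G \<phi> (w j k) = v (j, k))"
      if "j \<in> J" for j
      using v that
      by (intro w[OF that, unfolded universal_tensors_def, THEN conjunct2, rule_format]) auto
    then have "\<forall>j. \<exists>\<phi>. j \<in> J \<longrightarrow> \<phi> \<in> CC sL (E j) G \<and> (\<forall>k\<in>K j. amplification sL G \<phi> (w j k) = v (j, k))"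
      by blast
    then obtain \<phi> where \<phi>: "\<And>j. j \<in> J \<Longrightarrow> \<phi> j \<in> CC sL (E j) G"
      "\<And>j k. j \<in> J \<Longrightarrow> k \<in> K j \<Longrightarrow> amplification sL G (\<phi> j) (w j k) = v (j, k)"
      by metis
    obtain \<psi> where \<psi>: "\<psi> \<in> CC sL X G" "\<forall>j\<in>J. restrict (\<lambda>x. \<psi> (coord_inj j x)) (carr (E j)) = \<phi> j"
      using CC_oplus1_exists[OF G \<phi>(1)] by blast
    show "\<exists>!\<phi>. \<phi> \<in> CC sL X G \<and>
        (\<forall>p\<in>Sigma J K. amplification sL G \<phi> (case p of (j, k) \<Rightarrow> inc j (w j k)) = v p)"
    proof (rule ex1I)
      show "\<psi> \<in> CC sL X G \<and>
          (\<forall>p\<in>Sigma J K. amplification sL G \<psi> (case p of (j, k) \<Rightarrow> inc j (w j k)) = v p)"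
        using \<psi> \<phi>(2) by (auto simp: amp)
    next
      fix \<chi> assume \<chi>: "\<chi> \<in> CC sL X G \<and>
          (\<forall>p\<in>Sigma J K. amplification sL G \<chi> (case p of (j, k) \<Rightarrow> inc j (w j k)) = v p)"
      show "\<chi> = \<psi>"
      proof (rule CC_oplus1_eqI[OF _ \<psi>(1) is_lspace_linear[OF G]])
        fix j x assume j: "j \<in> J" and x: "x \<in> carr (E j)"
        have "amplification sL G (restrict (\<lambda>x. \<chi> (coord_inj j x)) (carr (E j))) (w j k) = v (j, k)"
          if "k \<in> K j" for k
          using \<chi> j that amp[of \<chi> j k] by fastforce
        then have "restrict (\<lambda>x. \<chi> (coord_inj j x)) (carr (E j)) = \<phi> j"
          using unique[OF j] CC_comp_coord_inj[of \<chi> G j] \<chi> \<phi> j by blast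
        then have "restrict (\<lambda>x. \<chi> (coord_inj j x)) (carr (E j)) x =
            restrict (\<lambda>x. \<psi> (coord_inj j x)) (carr (E j)) x"
          using \<psi>(2) j by simp
        then show "\<chi> (coord_inj j x) = \<psi> (coord_inj j x)" using x by simp
      qed (use \<chi> in blast)
    qed
  qed
qed

end

text \<open>Evaluation at the universal tensors, called \<open>R\<close> in the proof, is a
  bijection from the morphisms onto the functions into the product of balls; the bijection required
  for freeness is its inverse.\<close>

lemma free_lspace_universal:
  fixes sL :: "'k::real_or_complex \<Rightarrow> 'l::real_normed_vector \<Rightarrow> 'l"
    and F :: "('k, 'l, 'f::ab_group_add) lspace"
    and w :: "'t \<times> 'i \<Rightarrow> ('k, 'l, 'f) tensor"
  assumes F: "is_lspace sL F"
    and w: "\<And>E :: ('k, 'l, 'e::ab_group_add) lspace. is_lspace sL E \<Longrightarrow>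
      universal_tensors sL F (M \<times> \<Lambda>) (\<lambda>(t, \<nu>). Lsub \<nu>) w E"
  shows "free_lspace sL (odot_obj sL \<Lambda> Lsub :: ('k, 'l, 'e) lspace \<Rightarrow> _) (odot_mor sL \<Lambda>) M F"
proof -
  let ?odot = "odot_obj sL \<Lambda> Lsub :: ('k, 'l, 'e) lspace \<Rightarrow> _"
  define R :: "('k, 'l, 'e) lspace \<Rightarrow> ('f \<Rightarrow> 'e) \<Rightarrow> 't \<Rightarrow> 'i \<Rightarrow> ('k, 'l, 'e) tensor" where
    "R E \<phi> = (\<lambda>t\<in>M. \<lambda>\<nu>\<in>\<Lambda>. amplification sL E \<phi> (w (t, \<nu>)))" for E \<phi>
  define I where "I E = inv_into (CC sL F E) (R E)" for E
  \<comment> \<open>Membership of the tensors is extracted from universality for some test space,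
    hence the hypothesis on \<open>E\<close>.\<close>
  have w_in: "w (t, \<nu>) \<in> tensor_space sL (Lsub \<nu>) F" "lnorm F (w (t, \<nu>)) \<le> 1"
    if "is_lspace sL (E :: ('k, 'l, 'e) lspace)" "t \<in> M" "\<nu> \<in> \<Lambda>" for E t \<nu>
    using w[OF that(1)] that(2,3) by (auto simp: universal_tensors_def)
  have bij: "bij_betw (R E) (CC sL F E) (M \<rightarrow>\<^sub>E ?odot E)" if E: "is_lspace sL E" for E
  proof (rule bij_betwI')
    have amp_in: "amplification sL E \<phi> (w (t, \<nu>)) \<in> tensor_space sL (Lsub \<nu>) E"
      "lnorm E (amplification sL E \<phi> (w (t, \<nu>))) \<le> 1"
      if "\<phi> \<in> CC sL F E" "t \<in> M" "\<nu> \<in> \<Lambda>" for \<phi> t \<nu>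
      using that w_in[OF E that(2,3)] tensor_space_UNIV[OF w_in(1)[OF E that(2,3)]]
      by (force simp: CC_iff intro: amplification_in_tensor_space order_trans)+
    show "R E \<phi> \<in> M \<rightarrow>\<^sub>E ?odot E" if "\<phi> \<in> CC sL F E" for \<phi>
      using amp_in[OF that] by (auto simp: R_def odot_obj_def)
    show "(R E \<phi> = R E \<psi>) = (\<phi> = \<psi>)" if \<phi>: "\<phi> \<in> CC sL F E" and \<psi>: "\<psi> \<in> CC sL F E" for \<phi> \<psi>
    proof
      assume eq: "R E \<phi> = R E \<psi>"
      have "amplification sL E \<psi> (w p) = amplification sL E \<phi> (w p)" if p: "p \<in> M \<times> \<Lambda>" for p
      proof -
        obtain t \<nu> where "p = (t, \<nu>)" "t \<in> M" "\<nu> \<in> \<Lambda>" using p by auto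
        then show ?thesis using fun_cong[OF fun_cong[OF eq, of t], of \<nu>] by (simp add: R_def)
      qed
      \<comment> \<open>Uniqueness in the universal property, with the images of the tensors under
        \<open>\<phi>\<close> itself as the prescribed family, gives injectivity of
        \<open>R\<close>.\<close>
      moreover have "\<exists>!\<chi>. \<chi> \<in> CC sL F E \<and>
          (\<forall>p\<in>M \<times> \<Lambda>. amplification sL E \<chi> (w p) = amplification sL E \<phi> (w p))"
        using amp_in[OF \<phi>]
        by (intro w[OF E, unfolded universal_tensors_def, THEN conjunct2, rule_format]) auto
      ultimately show "\<phi> = \<psi>" using \<phi> \<psi> by blast
    qed simp
    fix f assume f: "f \<in> M \<rightarrow>\<^sub>E ?odot E"
    have f_in: "f t \<nu> \<in> tensor_space sL (Lsub \<nu>) E" "lnorm E (f t \<nu>) \<le> 1"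
      if "t \<in> M" "\<nu> \<in> \<Lambda>" for t \<nu>
    proof -
      have "f t \<in> ?odot E" using f that(1) by blast
      then show "f t \<nu> \<in> tensor_space sL (Lsub \<nu>) E" "lnorm E (f t \<nu>) \<le> 1"
        using that(2) by (auto simp: odot_obj_def)
    qed
    then have "\<exists>!\<chi>. \<chi> \<in> CC sL F E \<and>
        (\<forall>p\<in>M \<times> \<Lambda>. amplification sL E \<chi> (w p) = (case p of (t, \<nu>) \<Rightarrow> f t \<nu>))"
      by (intro w[OF E, unfolded universal_tensors_def, THEN conjunct2, rule_format]) auto
    then obtain \<chi> where \<chi>: "\<chi> \<in> CC sL F E" "\<And>t \<nu>. t \<in> M \<Longrightarrow> \<nu> \<in> \<Lambda> \<Longrightarrow> amplification sL E \<chi> (w (t, \<nu>)) = f t \<nu>"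
      by (auto dest!: ex1_implies_ex)
    have "R E \<chi> = f"
    proof (rule extensionalityI[of _ M])
      fix t assume t: "t \<in> M"
      have "f t \<in> ?odot E" using f t by blast
      then have "f t \<in> extensional \<Lambda>" by (simp add: odot_obj_def PiE_def)
      then show "R E \<chi> t = f t"
        using t \<chi>(2) by (intro extensionalityI[of _ \<Lambda>]) (auto simp: R_def)
    qed (use f in \<open>simp_all add: R_def PiE_def\<close>)
    then show "\<exists>\<chi>\<in>CC sL F E. f = R E \<chi>" using \<chi>(1) by blast
  qed
  have "bij_betw (I E) (M \<rightarrow>\<^sub>E ?odot E) (CC sL F E)" if "is_lspace sL E" for E
    unfolding I_def by (rule bij_betw_inv_into[OF bij[OF that]])
  moreover have "compose (carr F) \<phi> (I G f) = I E (compose M (odot_mor sL \<Lambda> G E \<phi>) f)"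
    if G: "is_lspace sL G" and E: "is_lspace sL E" and \<phi>: "\<phi> \<in> CC sL G E" and f: "f \<in> M \<rightarrow>\<^sub>E ?odot G"
    for G E \<phi> f
  proof -
    have \<psi>: "I G f \<in> CC sL F G" "R G (I G f) = f"
      using bij_betwE[OF bij_betw_inv_into[OF bij[OF G]]] bij_betw_inv_into_right[OF bij[OF G]] f
      by (auto simp: I_def)
    note linF = is_lspace_linear[OF F]
    \<comment> \<open>Naturality is checked after applying \<open>R\<close>, where it says that the
      amplification of a composite is the composite of the amplifications.\<close>
    define \<chi> where "\<chi> = compose (carr F) \<phi> (I G f)"
    have \<chi>: "\<chi> \<in> CC sL F E" unfolding \<chi>_def by (rule compose_in_CC[OF linF \<phi> \<psi>(1)])
    have "amplification sL E \<chi> (w (t, \<nu>)) = amplification sL E \<phi> (f t \<nu>)" if t: "t \<in> M" "\<nu> \<in> \<Lambda>" for t \<nu>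
    proof -
      have "amplification sL G (I G f) (w (t, \<nu>)) = f t \<nu>"
        using fun_cong[OF fun_cong[OF \<psi>(2), of t], of \<nu>] t by (simp add: R_def)
      then show ?thesis
        using amplification_compose[OF linF \<phi> \<psi>(1) w_in(1)[OF E t]] by (simp add: \<chi>_def)
    qed
    then have "R E \<chi> = compose M (odot_mor sL \<Lambda> G E \<phi>) f"
      by (auto simp: R_def compose_def odot_mor_def fun_eq_iff restrict_def)
    then show ?thesis
      using bij_betw_inv_into_left[OF bij[OF E] \<chi>] by (simp add: I_def \<chi>_def)
  qed
  ultimately show ?thesis unfolding free_lspace_def using F by blast
qed

section \<open>Duals of contractively complemented subspaces\<close>

text \<open>Purely algebraic: an L-space carries a norm only on its tensor product with
  \<open>L\<close>, so the functional comes from extending a linearly independent set to a basis and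
  not from the Hahn-Banach theorem.\<close>

lemma exists_separating_linear_functional:
  fixes s :: "'k::field \<Rightarrow> 'e::ab_group_add \<Rightarrow> 'e"
  assumes "vector_space s" "y \<noteq> 0"
  obtains g where "linear_on s (*) UNIV g" "g y \<noteq> 0"
proof -
  interpret V: vector_space s by (rule assms(1))
  interpret K: vector_space "(*) :: 'k \<Rightarrow> 'k \<Rightarrow> 'k"
    by standard (simp_all add: algebra_simps)
  interpret VK: vector_space_pair s "(*) :: 'k \<Rightarrow> 'k \<Rightarrow> 'k" ..
  obtain g where g: "Vector_Spaces.linear s (*) g" "g y = 1"
    using VK.linear_independent_extend[of "{y}" "\<lambda>_. 1"] assms(2) by auto
  interpret g: Vector_Spaces.linear s "(*)" g by (rule g(1))
  show thesis
    by (rule that[of g]) (simp_all add: linear_on_def g.add g.scale g(2))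
qed

section \<open>The dual of a subspace as a linear space of functionals\<close>

lemma dual_carr_add:
  assumes "g \<in> dual_carr sL S" "h \<in> dual_carr sL S"
  shows "(\<lambda>x. g x + h x) \<in> dual_carr sL S"
proof -
  obtain C D where "\<forall>x\<in>S. norm (g x) \<le> C * norm x" "\<forall>x\<in>S. norm (h x) \<le> D * norm x"
    using assms by (auto simp: dual_carr_def)
  then have "\<forall>x\<in>S. norm (g x + h x) \<le> (C + D) * norm x"
    by (auto simp: distrib_right intro: norm_triangle_le add_mono)
  then have "\<exists>C. \<forall>x\<in>S. norm (g x + h x) \<le> C * norm x" ..
  then show ?thesis
    using assms by (auto simp: dual_carr_def linear_on_def algebra_simps)
qed

lemma dual_carr_scale:
  assumes "g \<in> dual_carr sL S"
  shows "(\<lambda>x. c * g x) \<in> dual_carr sL S"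
proof -
  obtain C where "\<forall>x\<in>S. norm (g x) \<le> C * norm x"
    using assms by (auto simp: dual_carr_def)
  then have "\<forall>x\<in>S. norm (c * g x) \<le> (norm c * C) * norm x"
    by (auto simp: norm_mult mult.assoc intro: mult_left_mono)
  then have "\<exists>C. \<forall>x\<in>S. norm (c * g x) \<le> C * norm x" ..
  then show ?thesis
    using assms by (auto simp: dual_carr_def linear_on_def algebra_simps)
qed

lemma dual_carr_0: "(\<lambda>x. 0) \<in> dual_carr sL S"
  by (auto simp: dual_carr_def linear_on_def intro: exI[of _ 0])

lemma dual_carr_sum:
  "(\<And>i. i \<in> A \<Longrightarrow> g i \<in> dual_carr sL S) \<Longrightarrow> (\<lambda>x. \<Sum>i\<in>A. g i x) \<in> dual_carr sL S"
  by (induction A rule: infinite_finite_induct) (auto simp: dual_carr_0 dual_carr_add)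

lemma dual_carr_bdd_above:
  assumes "h \<in> dual_carr sL S"
  shows "bdd_above ((\<lambda>x. norm (h x)) ` {x \<in> S. norm x \<le> 1})"
proof -
  obtain C where C: "\<And>x. x \<in> S \<Longrightarrow> norm (h x) \<le> C * norm x"
    using assms by (auto simp: dual_carr_def)
  \<comment> \<open>\<open>C\<close> may be negative when 0 is the only vector of \<open>S\<close>,
    hence the absolute value.\<close>
  have "norm (h x) \<le> \<bar>C\<bar>" if "x \<in> S" "norm x \<le> 1" for x
  proof -
    have "C * norm x \<le> \<bar>C\<bar> * 1"
      using that(2) by (intro mult_mono) auto
    then show ?thesis using C[OF that(1)] by simp
  qed
  then show ?thesis by (intro bdd_aboveI2) auto
qed

lemma dual_norm_ge: "h \<in> dual_carr sL S \<Longrightarrow> x \<in> S \<Longrightarrow> norm x \<le> 1 \<Longrightarrow> norm (h x) \<le> dual_norm S h"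
  unfolding dual_norm_def by (intro cSUP_upper dual_carr_bdd_above) auto

lemma carr_F_nu: "carr (F_nu sL S) = dual_carr sL S"
  and scal_F_nu: "scal (F_nu sL S) = (\<lambda>c f x. c * f x)"
  by (simp_all add: F_nu_def minimal_lspace_def)

lemma lnorm_F_nu: "lnorm (F_nu sL S) u =
    (SUP (f, g) \<in> unit_functionals sL UNIV norm \<times> unit_functionals (\<lambda>c f x. c * f x) (dual_carr sL S) (dual_norm S).
      norm (u (\<lambda>\<xi> x. f \<xi> * g x)))"
  by (simp add: F_nu_def minimal_lspace_def)

lemma linear_F_nu:
  fixes sL :: "'k::real_or_complex \<Rightarrow> 'l::real_normed_vector \<Rightarrow> 'l"
  shows "linear_lspace (F_nu sL S)"
proof -
  have vs: "vector_space (\<lambda>c (f :: 'l \<Rightarrow> 'k) x. c * f x)"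
    by standard (simp_all add: fun_eq_iff algebra_simps)
  interpret vector_space "\<lambda>c (f :: 'l \<Rightarrow> 'k) x. c * f x" by (rule vs)
  have "subspace (dual_carr sL S)"
    by (rule subspaceI) (simp_all add: zero_fun_def plus_fun_def dual_carr_0 dual_carr_add dual_carr_scale)
  with vs show ?thesis by (simp add: linear_lspace_def carr_F_nu scal_F_nu)
qed

section \<open>Bounded operators and coordinates on finite-dimensional subspaces\<close>

context normed_space_over
begin

lemma bounded_operators_add:
  "a \<in> bounded_operators scale \<Longrightarrow> b \<in> bounded_operators scale \<Longrightarrow> (\<lambda>x. a x + b x) \<in> bounded_operators scale"
  by (simp add: bounded_operators_def bounded_linear_add scale_right_distrib)

lemma bounded_linear_scale: "bounded_linear (scale c)"
proof (rule bounded_linear_intro)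
  show "scale c (x + y) = scale c x + scale c y" for x y by (rule scale_right_distrib)
  show "scale c (r *\<^sub>R x) = r *\<^sub>R scale c x" for r x
    by (simp add: scale_left_commute flip: scale_of_real)
  show "norm (scale c x) \<le> norm x * norm c" for x by (simp add: norm_scale)
qed

lemma bounded_operators_scale:
  assumes "a \<in> bounded_operators scale"
  shows "(\<lambda>x. scale c (a x)) \<in> bounded_operators scale"
  using assms bounded_linear_compose[OF bounded_linear_scale, of a c]
  by (simp add: bounded_operators_def scale_left_commute)

lemma bounded_operators_comp:
  "a \<in> bounded_operators scale \<Longrightarrow> b \<in> bounded_operators scale \<Longrightarrow> (\<lambda>x. a (b x)) \<in> bounded_operators scale"
  by (simp add: bounded_operators_def bounded_linear_compose)

lemma bounded_operators_rank_one:
  assumes "h \<in> dual_carr scale UNIV"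
  shows "(\<lambda>x. scale (h x) \<xi>) \<in> bounded_operators scale"
proof -
  obtain C where C: "\<And>x. norm (h x) \<le> C * norm x" and h: "linear_on scale (*) UNIV h"
    using assms by (auto simp: dual_carr_def)
  have "bounded_linear (\<lambda>x. scale (h x) \<xi>)"
  proof (rule bounded_linear_intro)
    show "scale (h (x + y)) \<xi> = scale (h x) \<xi> + scale (h y) \<xi>" for x y
      by (simp add: linear_on_add[OF h] scale_left_distrib)
    show "scale (h (r *\<^sub>R x)) \<xi> = r *\<^sub>R scale (h x) \<xi>" for r x
      by (simp add: linear_on_scale[OF h] flip: scale_of_real)
    show "norm (scale (h x) \<xi>) \<le> norm x * (C * norm \<xi>)" for x
      using mult_right_mono[OF C[of x], of "norm \<xi>"] by (simp add: norm_scale algebra_simps)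
  qed
  then show ?thesis
    by (simp add: bounded_operators_def linear_on_scale[OF h])
qed

text \<open>Only norms enter \<open>onorm\<close>, so \<open>c\<close> may be replaced by the real
  scalar \<open>norm c\<close>.\<close>

lemma onorm_scale:
  assumes "bounded_linear a"
  shows "onorm (\<lambda>x. scale c (a x)) = norm c * onorm a"
proof -
  have "onorm (\<lambda>x. scale c (a x)) = onorm (\<lambda>x. norm c *\<^sub>R a x)"
    by (simp add: onorm_def norm_scale)
  then show ?thesis using onorm_scaleR[OF assms, of "norm c"] by simp
qed

lemma unit_functionals_dual_carr: "f \<in> unit_functionals scale UNIV norm \<Longrightarrow> f \<in> dual_carr scale UNIV"
  by (auto simp: unit_functionals_def dual_carr_def intro: exI[of _ 1])

text \<open>Induction on a spanning set, adjoining one coordinate at a time. The functionals have to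
  be bounded on the whole space, so each new one is built from a norming functional.\<close>

lemma finite_dim_coordinates:
  assumes "finite B"
  shows "\<exists>(n::nat) e f. (\<forall>i<n. e i \<in> span B \<and> f i \<in> dual_carr scale UNIV) \<and>
    (\<forall>x\<in>span B. x = (\<Sum>i<n. scale (f i x) (e i)))"
  using assms
proof induction
  case empty
  show ?case by (intro exI[of _ "0::nat"]) simp
next
  case (insert b B)
  then obtain n :: nat and e f where ef: "\<And>i. i < n \<Longrightarrow> e i \<in> span B"
      "\<And>i. i < n \<Longrightarrow> f i \<in> dual_carr scale UNIV"
    and coord: "\<And>x. x \<in> span B \<Longrightarrow> x = (\<Sum>i<n. scale (f i x) (e i))"
    by blast
  \<comment> \<open>\<open>Q\<close> measures how far the present coordinates fail to reproduce
    \<open>y\<close>. It vanishes on the span of \<open>B\<close>, so on the larger span it takes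
    only multiples of \<open>Q b\<close> as values.\<close>
  define Q where "Q y = y - (\<Sum>i<n. scale (f i y) (e i))" for y
  have f_lin: "linear_on scale (*) UNIV (f i)" if "i < n" for i
    using ef(2)[OF that] by (simp add: dual_carr_def)
  have Q0: "Q x = 0" if "x \<in> span B" for x using coord[OF that] by (simp add: Q_def)
  have Q_add: "Q (x + scale k y) = Q x + scale k (Q y)" for x y k
  proof -
    have "(\<Sum>i<n. scale (f i (x + scale k y)) (e i)) =
        (\<Sum>i<n. scale (f i x) (e i) + scale k (scale (f i y) (e i)))"
      by (intro sum.cong refl)
        (simp add: linear_on_add[OF f_lin] linear_on_scale[OF f_lin] scale_left_distrib)
    then show ?thesis
      by (simp add: Q_def sum.distrib scale_sum_right scale_right_diff_distrib)
  qed
  have e_in: "e i \<in> span (insert b B)" if "i < n" for i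
    using ef(1)[OF that] span_mono[of B "insert b B"] by blast
  have Q_span: "\<exists>k. Q y = scale k (Q b)" if y: "y \<in> span (insert b B)" for y
  proof -
    obtain k where k: "y - scale k b \<in> span B" using y unfolding span_insert by blast
    then have "Q y = scale k (Q b)" using Q_add[of "y - scale k b" k b] Q0[OF k] by simp
    then show ?thesis ..
  qed
  show ?case
  proof (cases "Q b = 0")
    case True
    then have "Q x = 0" if "x \<in> span (insert b B)" for x using Q_span[OF that] by auto
    then have "\<forall>x\<in>span (insert b B). x = (\<Sum>i<n. scale (f i x) (e i))"
      by (simp add: Q_def)
    then show ?thesis using e_in ef(2) by blast
  next
    case False
    obtain F where F: "F \<in> unit_functionals scale UNIV norm" "norm (F (Q b)) = norm (Q b)"
      by (rule exists_norming_functional)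
    then have F_lin: "linear_on scale (*) UNIV F" by (simp add: unit_functionals_def)
    from F False have FQb: "F (Q b) \<noteq> 0" by auto
    \<comment> \<open>This is \<open>F (Q y)\<close> divided by \<open>F (Q b)\<close>, written out
      so that the closure properties of the dual apply. On the larger span it is the factor
      \<open>k\<close> with \<open>Q x = scale k (Q b)\<close>.\<close>
    define g where "g y = inverse (F (Q b)) * (F y + (- 1) * (\<Sum>i<n. F (e i) * f i y))" for y
    have "F (\<Sum>i<n. scale (f i y) (e i)) = (\<Sum>i<n. F (e i) * f i y)" for y
    proof -
      have "F (\<Sum>i\<in>A. scale (f i y) (e i)) = (\<Sum>i\<in>A. F (e i) * f i y)" for A
        using linear_on_0[OF F_lin]
        by (induction A rule: infinite_finite_induct)
          (simp_all add: linear_on_add[OF F_lin] linear_on_scale[OF F_lin] mult.commute)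
      then show ?thesis .
    qed
    moreover have "F (x - y) = F x - F y" for x y
      using linear_on_add[OF F_lin, of "x - y" y] by simp
    ultimately have g_eq: "g y = inverse (F (Q b)) * F (Q y)" for y
      by (simp add: g_def Q_def)
    have g: "g \<in> dual_carr scale UNIV"
      unfolding g_def using ef(2) unit_functionals_dual_carr[OF F(1)]
      by (intro dual_carr_scale dual_carr_add dual_carr_sum) auto
    have "Q b \<in> span (insert b B)"
      unfolding Q_def using e_in by (intro span_diff span_sum span_scale span_base[of b]) auto
    \<comment> \<open>Adjoining \<open>Q b\<close> rather than \<open>b\<close> leaves the earlier
      coordinates unchanged: \<open>x\<close> is its old expansion plus \<open>Q x\<close>.\<close>
    moreover have "x = (\<Sum>i<Suc n. scale ((f(n := g)) i x) ((e(n := Q b)) i))"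
      if x: "x \<in> span (insert b B)" for x
    proof -
      obtain k where k: "Q x = scale k (Q b)" using Q_span[OF x] by blast
      then have "g x = k" using FQb by (simp add: g_eq linear_on_scale[OF F_lin])
      then show ?thesis using k by (simp add: Q_def algebra_simps)
    qed
    ultimately show ?thesis
      using e_in ef(2) g by (intro exI[of _ "Suc n"] exI[of _ "e(n := Q b)"] exI[of _ "f(n := g)"]) auto
  qed
qed

end

text \<open>Idempotence of \<open>P\<close> appears as its fixing the points of its range
  \<open>S\<close>. The functionals \<open>f i\<close> live on the whole space, and the
  \<open>e i\<close> need not be a basis: \<open>f j (e i)\<close> is not assumed to be a Kronecker
  delta.\<close>

locale complemented_subspace = normed_space_over scale
  for scale :: "'k::real_or_complex \<Rightarrow> 'l::real_normed_vector \<Rightarrow> 'l" +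
  fixes S :: "'l set" and P :: "'l \<Rightarrow> 'l" and n :: nat and e :: "nat \<Rightarrow> 'l" and f :: "nat \<Rightarrow> 'l \<Rightarrow> 'k"
  assumes P: "P \<in> bounded_operators scale" "onorm P \<le> 1" "range P = S" "\<And>x. x \<in> S \<Longrightarrow> P x = x"
    and e: "\<And>i. i < n \<Longrightarrow> e i \<in> S"
    and f: "\<And>i. i < n \<Longrightarrow> f i \<in> dual_carr scale UNIV"
    and coordinates: "\<And>x. x \<in> S \<Longrightarrow> x = (\<Sum>i<n. scale (f i x) (e i))"
begin

abbreviation F :: "('k, 'l, 'l \<Rightarrow> 'k) lspace" where "F \<equiv> F_nu scale S"

text \<open>Cut off outside \<open>S\<close>, because the members of \<open>dual_carr\<close> vanish
  there.\<close>

definition f_restr :: "nat \<Rightarrow> 'l \<Rightarrow> 'k" where "f_restr i = (\<lambda>x. if x \<in> S then f i x else 0)"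

text \<open>This tensor corresponds to the inclusion of \<open>S\<close> under the identification of \<open>L \<otimes> S\<^sup>*\<close> with
  the operators from \<open>S\<close> to \<open>L\<close>.\<close>

definition incl_tensor :: "('k, 'l, 'l \<Rightarrow> 'k) tensor" where
  "incl_tensor = (\<Sum>i<n. elem_tensor scale F (e i) (f_restr i))"

text \<open>These are the operators from \<open>S\<close> to \<open>L\<close>, extended through the
  projection. Since \<open>P\<close> is contractive, the extension has the same norm; as a bounded
  operator on \<open>L\<close> it can act on every L-space.\<close>

definition operators :: "('l \<Rightarrow> 'l) set" where
  "operators = {T \<in> bounded_operators scale. \<forall>x. T (P x) = T x}"

section \<open>The tensor product of L and the dual as a space of operators\<close>

lemma operators_bounded: "T \<in> operators \<Longrightarrow> T \<in> bounded_operators scale"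
  by (simp add: operators_def)

lemma operators_linear_on: "T \<in> operators \<Longrightarrow> linear_on scale scale UNIV T"
  by (rule bounded_operators_linear_on[OF operators_bounded])

lemma P_in: "P x \<in> S" using P(3) by blast

lemma P_in_operators: "P \<in> operators"
  by (simp add: operators_def P(1,4) P_in)

lemma P_linear: "linear_on scale scale UNIV P"
  by (rule operators_linear_on[OF P_in_operators])

lemma norm_P_le: "norm (P x) \<le> norm x"
proof -
  have "norm (P x) \<le> onorm P * norm x" using P(1) by (simp add: bounded_operators_def onorm)
  also have "\<dots> \<le> 1 * norm x" by (intro mult_right_mono P(2)) simp
  finally show ?thesis by simp
qed

lemma S_add: "x \<in> S \<Longrightarrow> y \<in> S \<Longrightarrow> x + y \<in> S"
  and S_scale: "x \<in> S \<Longrightarrow> scale c x \<in> S"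
  by (metis P(4) P_in linear_on_add[OF P_linear] UNIV_I)
    (metis P(4) P_in linear_on_scale[OF P_linear] UNIV_I)

lemma S_0: "0 \<in> S"
  using P_in[of 0] linear_on_0[OF P_linear] by simp

lemma S_sum: "(\<And>i. i \<in> A \<Longrightarrow> x i \<in> S) \<Longrightarrow> (\<Sum>i\<in>A. x i) \<in> S"
  by (induction A rule: infinite_finite_induct) (auto simp: S_0 S_add)

lemma restrict_dual_carr:
  "h \<in> dual_carr scale UNIV \<Longrightarrow> (\<lambda>x. if x \<in> S then h x else 0) \<in> dual_carr scale S"
  by (auto simp: dual_carr_def linear_on_def S_add S_scale)

lemma f_restr: "i < n \<Longrightarrow> f_restr i \<in> carr F"
  unfolding f_restr_def carr_F_nu by (intro restrict_dual_carr f)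

text \<open>Inside \<open>S\<close>, apply \<open>h\<close> to the coordinate expansion of the
  argument; outside, both sides are 0.\<close>

lemma dual_expansion:
  assumes "h \<in> carr F"
  shows "h = (\<Sum>i<n. scal F (h (e i)) (f_restr i))"
proof
  fix x
  have h: "linear_on scale (*) S h" "x \<notin> S \<Longrightarrow> h x = 0"
    using assms by (auto simp: carr_F_nu dual_carr_def)
  show "h x = (\<Sum>i<n. scal F (h (e i)) (f_restr i)) x"
  proof (cases "x \<in> S")
    case True
    have *: "h (\<Sum>i\<in>A. scale (f i x) (e i)) = (\<Sum>i\<in>A. h (e i) * f i x)" if "A \<subseteq> {..<n}" for A
      using finite_subset[OF that finite_lessThan] that
    proof induction
      case empty
      show ?case using linear_on_0[OF h(1) S_0] by simp
    next
      case (insert i A)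
      then show ?case
        by (simp add: linear_on_add[OF h(1)] linear_on_scale[OF h(1)] e S_scale S_sum subset_eq mult.commute)
    qed
    show ?thesis
      using arg_cong[OF coordinates[OF True], of h] *[of "{..<n}"] True
      by (simp add: sum_fun_apply scal_F_nu f_restr_def)
  qed (simp add: h(2) sum_fun_apply scal_F_nu f_restr_def)
qed

lemma incl_tensor_in: "incl_tensor \<in> tensor_space scale S F"
  unfolding incl_tensor_def
  by (intro tensor_space_sum elem_tensor_in_tensor_space e f_restr) auto

lemma tensor_map_incl_tensor:
  assumes "linear_on scale scale UNIV a" "\<phi> \<in> linear_maps F E"
  shows "tensor_map scale E a \<phi> incl_tensor = (\<Sum>i<n. elem_tensor scale E (a (e i)) (\<phi> (f_restr i)))"
  unfolding incl_tensor_def tensor_map_sum tensor_map_elem[OF assms] ..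

lemma act_incl_tensor:
  "T \<in> operators \<Longrightarrow> act scale F T incl_tensor = (\<Sum>i<n. elem_tensor scale F (T (e i)) (f_restr i))"
  by (rule tensor_map_incl_tensor[OF operators_linear_on linear_maps_ident])

lemma act_incl_tensor_add:
  assumes "T \<in> operators" "U \<in> operators"
  shows "(\<lambda>x. T x + U x) \<in> operators"
    and "act scale F (\<lambda>x. T x + U x) incl_tensor = act scale F T incl_tensor + act scale F U incl_tensor"
proof -
  show *: "(\<lambda>x. T x + U x) \<in> operators"
    using assms by (simp add: operators_def bounded_operators_add)
  show "act scale F (\<lambda>x. T x + U x) incl_tensor = act scale F T incl_tensor + act scale F U incl_tensor"
    unfolding act_incl_tensor[OF *] act_incl_tensor[OF assms(1)] act_incl_tensor[OF assms(2)]
      sum.distrib[symmetric]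
    by (rule sum.cong[OF refl], rule elem_tensor_add_left[OF f_restr]) simp
qed

lemma act_incl_tensor_scale:
  assumes "T \<in> operators"
  shows "(\<lambda>x. scale c (T x)) \<in> operators"
    and "act scale F (\<lambda>x. scale c (T x)) incl_tensor = tensor_scale c (act scale F T incl_tensor)"
proof -
  show *: "(\<lambda>x. scale c (T x)) \<in> operators"
    using assms by (simp add: operators_def bounded_operators_scale)
  show "act scale F (\<lambda>x. scale c (T x)) incl_tensor = tensor_scale c (act scale F T incl_tensor)"
    unfolding act_incl_tensor[OF *] act_incl_tensor[OF assms(1)] tensor.scale_sum_right
    by (rule sum.cong[OF refl], rule elem_tensor_scale_left[OF f_restr]) simp
qed

lemma zero_in_operators: "(\<lambda>x. 0) \<in> operators"
  by (simp add: operators_def bounded_operators_def)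

lemma act_zero_incl_tensor: "act scale F (\<lambda>x. 0) incl_tensor = 0"
  unfolding act_incl_tensor[OF zero_in_operators]
  by (rule sum.neutral) (auto intro: elem_tensor_0_left[OF f_restr])

text \<open>Sums and multiples of tensors come from those of operators. The elementary tensor of
  \<open>\<xi>\<close> and \<open>h\<close> comes from the rank-one operator sending
  \<open>x\<close> to \<open>scale (h (P x)) \<xi>\<close>, which is bounded because composing with
  \<open>P\<close> extends \<open>h\<close> to a bounded functional on all of
  \<open>L\<close>.\<close>

lemma tensor_is_operator:
  assumes "u \<in> tensor_space scale UNIV F"
  shows "\<exists>T\<in>operators. u = act scale F T incl_tensor"
  using assms
proof (induction rule: tensor_space_induct)
  case zero
  show ?case by (rule bexI, rule act_zero_incl_tensor[symmetric], rule zero_in_operators)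
next
  case (add u v)
  then obtain T U where T: "T \<in> operators" "u = act scale F T incl_tensor"
    and U: "U \<in> operators" "v = act scale F U incl_tensor" by blast
  show ?case
    unfolding T(2) U(2)
    by (rule bexI, rule act_incl_tensor_add(2)[OF T(1) U(1), symmetric],
      rule act_incl_tensor_add(1)[OF T(1) U(1)])
next
  case (scale c u)
  then obtain T where T: "T \<in> operators" "u = act scale F T incl_tensor" by blast
  show ?case
    unfolding T(2)
    by (rule bexI, rule act_incl_tensor_scale(2)[OF T(1), symmetric],
      rule act_incl_tensor_scale(1)[OF T(1)])
next
  case (elem \<xi> h)
  then have h: "h \<in> dual_carr scale S" by (simp add: carr_F_nu)
  then obtain C where C: "\<And>x. x \<in> S \<Longrightarrow> norm (h x) \<le> C * norm x" and lin: "linear_on scale (*) S h"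
    by (auto simp: dual_carr_def)
  have "norm (h (P x)) \<le> \<bar>C\<bar> * norm x" for x
  proof -
    have "C * norm (P x) \<le> \<bar>C\<bar> * norm x" by (intro mult_mono norm_P_le) auto
    then show ?thesis using C[OF P_in, of x] by linarith
  qed
  then have "(\<lambda>x. h (P x)) \<in> dual_carr scale UNIV"
    using linear_on_comp[OF P_linear lin] P_in by (auto simp: dual_carr_def)
  then have T: "(\<lambda>x. scale (h (P x)) \<xi>) \<in> operators"
    using bounded_operators_rank_one P(4)[OF P_in] by (simp add: operators_def)
  \<comment> \<open>Expand \<open>h\<close> in the restricted coordinates and move its coefficients
    \<open>h (e i)\<close> to the left factor.\<close>
  have "elem_tensor scale F \<xi> h = elem_tensor scale F \<xi> (\<Sum>i<n. scal F (h (e i)) (f_restr i))"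
    using dual_expansion[OF elem(2)] by (rule arg_cong)
  also have "\<dots> = (\<Sum>i<n. elem_tensor scale F \<xi> (scal F (h (e i)) (f_restr i)))"
    by (intro elem_tensor_sum_right linear_F_nu carr_scal f_restr) auto
  also have "\<dots> = (\<Sum>i<n. elem_tensor scale F (scale (h (P (e i))) \<xi>) (f_restr i))"
    by (intro sum.cong refl)
      (simp add: elem_tensor_scale_right[OF f_restr] elem_tensor_scale_left[OF f_restr] P(4)[OF e])
  also have "\<dots> = act scale F (\<lambda>x. scale (h (P x)) \<xi>) incl_tensor"
    by (rule act_incl_tensor[OF T, symmetric])
  finally have eq: "elem_tensor scale F \<xi> h = act scale F (\<lambda>x. scale (h (P x)) \<xi>) incl_tensor" .
  show ?case by (rule bexI, rule eq, rule T)
qed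

text \<open>The pairing is the combination of the values \<open>g (f_restr i)\<close> with
  coefficients \<open>\<phi> (T (e i))\<close>. These are the coefficients of the pullback of
  \<open>\<phi>\<close> along \<open>T\<close>, so the dual expansion resums them.\<close>

lemma act_incl_tensor_apply:
  assumes T: "T \<in> operators" and \<phi>: "\<phi> \<in> unit_functionals scale UNIV norm"
    and g: "linear_on (scal F) (*) (carr F) g"
  shows "act scale F T incl_tensor (\<lambda>\<xi> x. \<phi> \<xi> * g x) = g (\<lambda>x. if x \<in> S then \<phi> (T x) else 0)"
proof -
  let ?B = "\<lambda>\<xi> x. \<phi> \<xi> * g x"
  let ?h = "\<lambda>x. if x \<in> S then \<phi> (T x) else 0"
  have \<phi>_lin: "linear_on scale (*) UNIV \<phi>" "\<And>x. norm (\<phi> x) \<le> norm x"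
    using \<phi> by (auto simp: unit_functionals_def)
  have B: "?B \<in> bilinear_forms scale F"
    using \<phi>_lin(1) g by (auto simp: bilinear_forms_def linear_on_def algebra_simps)
  have Tb: "bounded_linear T" using operators_bounded[OF T] by (simp add: bounded_operators_def)
  have "norm (\<phi> (T x)) \<le> onorm T * norm x" for x
    using \<phi>_lin(2)[of "T x"] onorm[OF Tb, of x] by linarith
  then have "(\<lambda>x. \<phi> (T x)) \<in> dual_carr scale UNIV"
    using linear_on_comp[OF operators_linear_on[OF T] \<phi>_lin(1)] by (auto simp: dual_carr_def)
  then have h: "?h \<in> carr F" unfolding carr_F_nu by (rule restrict_dual_carr)
  have "act scale F T incl_tensor ?B = (\<Sum>i<n. \<phi> (T (e i)) * g (f_restr i))"
    unfolding act_incl_tensor[OF T] by (simp add: sum_fun_apply elem_tensor_def B)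
  also have "\<dots> = (\<Sum>i<n. g (scal F (?h (e i)) (f_restr i)))"
    by (intro sum.cong refl) (simp add: linear_on_scale[OF g f_restr] e)
  also have "\<dots> = g (\<Sum>i<n. scal F (?h (e i)) (f_restr i))"
    by (rule linear_on_sum[OF g linear_F_nu refl, symmetric])
      (auto intro: carr_scal[OF linear_F_nu] f_restr)
  also have "\<dots> = g ?h" using dual_expansion[OF h] by simp
  finally show ?thesis .
qed

lemma lnorm_act_incl_tensor:
  assumes T: "T \<in> operators"
  shows "lnorm F (act scale F T incl_tensor) = onorm T"
proof -
  let ?U = "unit_functionals scale UNIV norm"
  let ?V = "unit_functionals (\<lambda>c f x. c * f x) (dual_carr scale S) (dual_norm S)"
  let ?val = "\<lambda>p. norm (act scale F T incl_tensor (\<lambda>\<xi> x. fst p \<xi> * snd p x))"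
  have Tb: "bounded_linear T" using operators_bounded[OF T] by (simp add: bounded_operators_def)
  have lnorm: "lnorm F (act scale F T incl_tensor) = (SUP p\<in>?U \<times> ?V. ?val p)"
    by (simp add: lnorm_F_nu case_prod_beta)
  have V_lin: "linear_on (scal F) (*) (carr F) g" if "g \<in> ?V" for g
    using that by (simp add: unit_functionals_def carr_F_nu scal_F_nu)
  \<comment> \<open>Upper bound: \<open>g\<close> has norm at most 1 on the dual, and the pullback
    of \<open>\<phi>\<close> along \<open>T\<close> has dual norm at most
    \<open>onorm T\<close>.\<close>
  have upper: "?val p \<le> onorm T" if "p \<in> ?U \<times> ?V" for p
  proof -
    obtain \<phi> g where p: "p = (\<phi>, g)" "\<phi> \<in> ?U" "g \<in> ?V" using \<open>p \<in> ?U \<times> ?V\<close> by auto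
    let ?h = "\<lambda>x. if x \<in> S then \<phi> (T x) else 0"
    have \<phi>: "norm (\<phi> x) \<le> norm x" for x using p(2) by (auto simp: unit_functionals_def)
    have \<phi>T: "norm (\<phi> (T x)) \<le> onorm T * norm x" for x
      using \<phi>[of "T x"] onorm[OF Tb, of x] by linarith
    have "linear_on scale (*) UNIV (\<lambda>x. \<phi> (T x))"
      using p(2) by (intro linear_on_comp[OF operators_linear_on[OF T]]) (auto simp: unit_functionals_def)
    then have "?h \<in> dual_carr scale S"
      using \<phi>T by (intro restrict_dual_carr) (auto simp: dual_carr_def)
    then have "?val p \<le> dual_norm S ?h"
      using p(3) act_incl_tensor_apply[OF T p(2) V_lin[OF p(3)]] by (simp add: p(1) unit_functionals_def)
    also have "\<dots> \<le> onorm T"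
      unfolding dual_norm_def
    proof (rule cSUP_least)
      show "{x \<in> S. norm x \<le> 1} \<noteq> {}" using S_0 by auto
      fix x assume x: "x \<in> {x \<in> S. norm x \<le> 1}"
      have "onorm T * norm x \<le> onorm T * 1"
        using x by (intro mult_left_mono onorm_pos_le Tb) auto
      then show "norm (?h x) \<le> onorm T" using \<phi>T[of x] x by simp
    qed
    finally show ?thesis .
  qed
  have "(\<lambda>_. 0) \<in> ?U" by (simp add: unit_functionals_def linear_on_def)
  moreover have "(\<lambda>_. 0) \<in> ?V"
    using S_0 by (auto simp: unit_functionals_def linear_on_def intro: order_trans[OF norm_ge_zero dual_norm_ge])
  ultimately have ne: "?U \<times> ?V \<noteq> {}" by blast
  have bdd: "bdd_above (?val ` (?U \<times> ?V))"
    using upper by (rule bdd_aboveI2)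
  have nonneg: "0 \<le> lnorm F (act scale F T incl_tensor)"
    unfolding lnorm using ne by (auto intro: cSUP_upper2[OF bdd])
  \<comment> \<open>Lower bound: since \<open>T y = T (P y)\<close>, it suffices to test on
    \<open>S\<close>. Evaluation at the unit vector in the direction of \<open>P y\<close> lies in
    the unit ball of the bidual; paired with a functional norming \<open>T y\<close>, it recovers
    the norm of \<open>T\<close> at that vector.\<close>
  have "onorm T \<le> lnorm F (act scale F T incl_tensor)"
  proof (rule onorm_bound[OF nonneg])
    fix y
    have Ty: "T y = T (P y)" using T by (simp add: operators_def)
    show "norm (T y) \<le> lnorm F (act scale F T incl_tensor) * norm y"
    proof (cases "P y = 0")
      case True
      then show ?thesis using nonneg linear_0[OF bounded_linear.linear[OF Tb]] by (simp add: Ty)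
    next
      case False
      let ?c = "inverse (norm (P y))"
      let ?s = "scale (of_real ?c) (P y)"
      have s: "?s \<in> S" "norm ?s = 1" using False by (simp_all add: S_scale P_in norm_scale norm_inverse)
      obtain \<phi> where \<phi>: "\<phi> \<in> ?U" "norm (\<phi> (T y)) = norm (T y)"
        by (rule exists_norming_functional)
      have g: "(\<lambda>h. h ?s) \<in> ?V"
      proof -
        have "norm (h ?s) \<le> dual_norm S h" if "h \<in> dual_carr scale S" for h
          using dual_norm_ge[OF that s(1)] s(2) by linarith
        then show ?thesis by (simp add: unit_functionals_def linear_on_def)
      qed
      have "\<phi> (T ?s) = of_real ?c * \<phi> (T y)"
        using \<phi>(1) linear_on_scale[OF operators_linear_on[OF T]]
        by (simp add: Ty unit_functionals_def linear_on_def)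
      then have "?c * norm (T y) = ?val (\<phi>, \<lambda>h. h ?s)"
        using act_incl_tensor_apply[OF T \<phi>(1) V_lin[OF g]] s(1) \<phi>(2)
        by (simp add: norm_mult norm_inverse)
      also have "\<dots> \<le> lnorm F (act scale F T incl_tensor)"
        unfolding lnorm using \<phi>(1) g by (intro cSUP_upper bdd) auto
      finally have "norm (T y) \<le> lnorm F (act scale F T incl_tensor) * norm (P y)"
        using False by (simp add: field_simps)
      \<comment> \<open>Contractivity of \<open>P\<close> passes the estimate from \<open>S\<close>
        to the whole space without loss.\<close>
      also have "\<dots> \<le> lnorm F (act scale F T incl_tensor) * norm y"
        by (intro mult_left_mono norm_P_le nonneg)
      finally show ?thesis .
    qed
  qed
  moreover have "lnorm F (act scale F T incl_tensor) \<le> onorm T"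
    unfolding lnorm using upper by (intro cSUP_least ne) auto
  ultimately show ?thesis by simp
qed

lemma operators_bounded_linear: "T \<in> operators \<Longrightarrow> bounded_linear T"
  by (simp add: operators_def bounded_operators_def)

text \<open>Every norm axiom is read off from the corresponding property of the operator norm; the
  action of \<open>a\<close> on a tensor becomes composition of \<open>a\<close> with its
  operator.\<close>

lemma is_lspace_F: "is_lspace scale F"
  unfolding is_lspace_def
proof (intro conjI ballI allI)
  show "vector_space (scal F)" "module.subspace (scal F) (carr F)"
    using linear_F_nu[of scale S] by (simp_all add: linear_lspace_def)
next
  fix u assume "u \<in> tensor_space scale UNIV F"
  then obtain T where T: "T \<in> operators" "u = act scale F T incl_tensor"
    using tensor_is_operator by blast
  note n = lnorm_act_incl_tensor[OF T(1), folded T(2)]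
  show "0 \<le> lnorm F u" unfolding n by (rule onorm_pos_le[OF operators_bounded_linear[OF T(1)]])
  show "(lnorm F u = 0) = (u = 0)"
  proof
    assume "lnorm F u = 0"
    then have "T = (\<lambda>x. 0)"
      using onorm_eq_0[OF operators_bounded_linear[OF T(1)]] by (auto simp: n)
    then show "u = 0" unfolding T(2) using act_zero_incl_tensor by metis
  next
    assume "u = 0"
    then show "lnorm F u = 0"
      using lnorm_act_incl_tensor[OF zero_in_operators] act_zero_incl_tensor onorm_zero by metis
  qed
  show "lnorm F (tensor_scale c u) = norm c * lnorm F u" for c
    unfolding n
    unfolding T(2) act_incl_tensor_scale(2)[OF T(1), symmetric]
      lnorm_act_incl_tensor[OF act_incl_tensor_scale(1)[OF T(1)]]
    by (rule onorm_scale[OF operators_bounded_linear[OF T(1)]])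
next
  fix u v assume "u \<in> tensor_space scale UNIV F" "v \<in> tensor_space scale UNIV F"
  then obtain T U where T: "T \<in> operators" "u = act scale F T incl_tensor"
    and U: "U \<in> operators" "v = act scale F U incl_tensor"
    using tensor_is_operator by metis
  show "lnorm F (u + v) \<le> lnorm F u + lnorm F v"
    unfolding T(2) U(2) act_incl_tensor_add(2)[OF T(1) U(1), symmetric]
      lnorm_act_incl_tensor[OF act_incl_tensor_add(1)[OF T(1) U(1)]]
      lnorm_act_incl_tensor[OF T(1)] lnorm_act_incl_tensor[OF U(1)]
    by (rule onorm_triangle[OF operators_bounded_linear[OF T(1)] operators_bounded_linear[OF U(1)]])
next
  fix a u assume a: "a \<in> bounded_operators scale" and "u \<in> tensor_space scale UNIV F"
  then obtain T where T: "T \<in> operators" "u = act scale F T incl_tensor"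
    using tensor_is_operator by blast
  have aT: "(\<lambda>x. a (T x)) \<in> operators"
    using a T(1) by (simp add: operators_def bounded_operators_comp)
  have "act scale F a u = act scale F (\<lambda>x. a (T x)) incl_tensor"
    unfolding T(2) by (rule tensor_map_comp[OF bounded_operators_linear_on[OF a] linear_maps_ident])
  then show "lnorm F (act scale F a u) \<le> onorm a * lnorm F u"
    using onorm_compose[of a T] a operators_bounded_linear[OF T(1)]
    by (simp add: T(2) lnorm_act_incl_tensor[OF T(1)] lnorm_act_incl_tensor[OF aT] comp_def
        bounded_operators_def)
qed

lemma act_P_incl_tensor: "act scale F P incl_tensor = incl_tensor"
  unfolding act_incl_tensor[OF P_in_operators] unfolding incl_tensor_def
  by (intro sum.cong refl) (simp add: P(4)[OF e])

text \<open>The operator attached to the universal tensor is \<open>P\<close>, so contractive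
  complementation places the tensor in the unit ball.\<close>

lemma lnorm_incl_tensor: "lnorm F incl_tensor \<le> 1"
  using lnorm_act_incl_tensor[OF P_in_operators] P(2) by (simp add: act_P_incl_tensor)

section \<open>Morphisms from the dual and their universal property\<close>

lemma tensor_coordinates:
  assumes "v \<in> tensor_space scale S E" and E: "linear_lspace E"
  shows "\<exists>x. (\<forall>i<n. x i \<in> carr E) \<and> v = (\<Sum>i<n. elem_tensor scale E (e i) (x i))"
  using assms(1)
proof (induction rule: tensor_space_induct)
  case zero
  have "0 = (\<Sum>i<n. elem_tensor scale E (e i) 0)"
    by (simp only: elem_tensor_0_right[OF carr_0[OF E]] sum.neutral_const)
  then show ?case using carr_0[OF E] by (intro exI[of _ "\<lambda>_. 0"]) blast
next
  case (add u v)
  then obtain x y where x: "\<forall>i<n. x i \<in> carr E" "u = (\<Sum>i<n. elem_tensor scale E (e i) (x i))"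
    and y: "\<forall>i<n. y i \<in> carr E" "v = (\<Sum>i<n. elem_tensor scale E (e i) (y i))" by blast
  have "u + v = (\<Sum>i<n. elem_tensor scale E (e i) (x i + y i))"
    unfolding x(2) y(2) sum.distrib[symmetric]
    using x(1) y(1) by (intro sum.cong refl elem_tensor_add_right[symmetric]) auto
  then show ?case using x(1) y(1) carr_add[OF E] by (intro exI[of _ "\<lambda>i. x i + y i"]) blast
next
  case (scale c u)
  then obtain x where x: "\<forall>i<n. x i \<in> carr E" "u = (\<Sum>i<n. elem_tensor scale E (e i) (x i))"
    by blast
  have "tensor_scale c u = (\<Sum>i<n. elem_tensor scale E (e i) (scal E c (x i)))"
    unfolding x(2) tensor.scale_sum_right
    using x(1) by (intro sum.cong refl elem_tensor_scale_right[symmetric]) auto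
  then show ?case using x(1) carr_scal[OF E] by (intro exI[of _ "\<lambda>i. scal E c (x i)"]) blast
next
  case (elem \<xi> x)
  \<comment> \<open>Replace \<open>\<xi>\<close> by its coordinate expansion and move the scalars
    into the factor from \<open>E\<close>.\<close>
  have "elem_tensor scale E \<xi> x = elem_tensor scale E (\<Sum>i<n. scale (f i \<xi>) (e i)) x"
    using coordinates[OF elem(1)] by simp
  also have "\<dots> = (\<Sum>i<n. elem_tensor scale E (scale (f i \<xi>) (e i)) x)"
    by (rule elem_tensor_sum_left[OF elem(2)])
  also have "\<dots> = (\<Sum>i<n. elem_tensor scale E (e i) (scal E (f i \<xi>) x))"
    by (simp only: elem_tensor_scale_left[OF elem(2)] elem_tensor_scale_right[OF elem(2)])
  finally show ?case using carr_scal[OF E elem(2)] by (intro exI[of _ "\<lambda>i. scal E (f i \<xi>) x"]) blast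
qed

text \<open>A morphism can be recovered from the image of the universal tensor: pairing the left
  factor with \<open>h \<circ> P\<close> and the right one with a functional \<open>g\<close>
  returns \<open>g (\<phi> h)\<close>, and linear functionals separate points of
  \<open>E\<close>.\<close>

lemma CC_F_eqI:
  assumes E: "linear_lspace E" and \<phi>: "\<phi> \<in> CC scale F E" and \<psi>: "\<psi> \<in> CC scale F E"
    and eq: "amplification scale E \<phi> incl_tensor = amplification scale E \<psi> incl_tensor"
  shows "\<phi> = \<psi>"
proof (rule extensionalityI[of _ "carr F"])
  show "\<phi> \<in> extensional (carr F)" "\<psi> \<in> extensional (carr F)"
    using \<phi> \<psi> by (simp_all add: CC_iff)
  fix h assume h: "h \<in> carr F"
  interpret E: vector_space "scal E" using E by (simp add: linear_lspace_def)
  show "\<phi> h = \<psi> h"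
  proof (rule ccontr)
    assume "\<phi> h \<noteq> \<psi> h"
    then obtain g where g: "linear_on (scal E) (*) UNIV g" "g (\<phi> h - \<psi> h) \<noteq> 0"
      using exists_separating_linear_functional[OF E.vector_space_axioms, of "\<phi> h - \<psi> h"] by auto
    let ?B = "\<lambda>\<xi> x. h (P \<xi>) * g x"
    have h_lin: "linear_on scale (*) S h" using h by (simp add: carr_F_nu dual_carr_def)
    have "linear_on scale (*) UNIV (\<lambda>\<xi>. h (P \<xi>))"
      using P_in by (intro linear_on_comp[OF P_linear h_lin])
    then have B: "?B \<in> bilinear_forms scale E"
      using g(1) by (auto simp: bilinear_forms_def linear_on_def algebra_simps)
    have "amplification scale E \<chi> incl_tensor ?B = g (\<chi> h)" if \<chi>: "\<chi> \<in> CC scale F E" for \<chi>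
    proof -
      have \<chi>': "\<chi> \<in> linear_maps F E" using \<chi> by (simp add: CC_iff)
      have lin: "linear_on (scal F) (*) (carr F) (\<lambda>x. g (\<chi> x))"
        using linear_on_comp[OF linear_maps_linear[OF \<chi>'] g(1)] by simp
      have "amplification scale E \<chi> incl_tensor ?B = (\<Sum>i<n. h (e i) * g (\<chi> (f_restr i)))"
        unfolding tensor_map_incl_tensor[OF linear_on_ident \<chi>']
        by (simp add: sum_fun_apply elem_tensor_def B P(4)[OF e])
      also have "\<dots> = (\<Sum>i<n. g (\<chi> (scal F (h (e i)) (f_restr i))))"
        by (intro sum.cong refl) (simp add: linear_on_scale[OF lin f_restr])
      also have "\<dots> = g (\<chi> (\<Sum>i<n. scal F (h (e i)) (f_restr i)))"
        by (rule linear_on_sum[OF lin linear_F_nu refl, symmetric])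
          (auto intro: carr_scal[OF linear_F_nu] f_restr)
      also have "\<dots> = g (\<chi> h)" using dual_expansion[OF h] by simp
      finally show ?thesis .
    qed
    then have "g (\<phi> h) = g (\<psi> h)" using eq \<phi> \<psi> by metis
    moreover have "g (\<phi> h) = g (\<phi> h - \<psi> h) + g (\<psi> h)"
      using linear_on_add[OF g(1), of "\<phi> h - \<psi> h" "\<psi> h"] by simp
    ultimately show False using g(2) by simp
  qed
qed

lemma CC_F_exists:
  assumes E: "is_lspace scale E" and v: "v \<in> tensor_space scale S E" "lnorm E v \<le> 1"
  obtains \<phi> where "\<phi> \<in> CC scale F E" "amplification scale E \<phi> incl_tensor = v"
proof -
  note linE = is_lspace_linear[OF E]
  interpret E: vector_space "scal E" using linE by (simp add: linear_lspace_def)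
  obtain x where x: "\<And>i. i < n \<Longrightarrow> x i \<in> carr E" "v = (\<Sum>i<n. elem_tensor scale E (e i) (x i))"
    using tensor_coordinates[OF v(1) linE] by blast
  \<comment> \<open>The contraction of \<open>v\<close> with \<open>h\<close> in the left
    factor.\<close>
  define \<phi> where "\<phi> h = (\<Sum>i<n. scal E (h (e i)) (x i))" for h
  have \<phi>: "\<phi> \<in> linear_maps F E"
    unfolding linear_maps_def
    using x(1) by (auto simp: \<phi>_def linear_on_def scal_F_nu E.scale_left_distrib sum.distrib
        E.scale_sum_right intro!: carr_sum[OF linE] carr_scal[OF linE])
  have amp: "amplification scale E \<phi> incl_tensor = v"
  proof -
    have "amplification scale E \<phi> incl_tensor = (\<Sum>j<n. elem_tensor scale E (e j) (\<phi> (f_restr j)))"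
      by (rule tensor_map_incl_tensor[OF linear_on_ident \<phi>])
    also have "\<dots> = (\<Sum>j<n. \<Sum>i<n. elem_tensor scale E (scale (f j (e i)) (e j)) (x i))"
    proof (rule sum.cong[OF refl])
      fix j assume "j \<in> {..<n}"
      have "elem_tensor scale E (e j) (\<phi> (f_restr j)) =
          (\<Sum>i<n. elem_tensor scale E (e j) (scal E (f_restr j (e i)) (x i)))"
        unfolding \<phi>_def using x(1) by (intro elem_tensor_sum_right linE carr_scal) auto
      also have "\<dots> = (\<Sum>i<n. elem_tensor scale E (scale (f j (e i)) (e j)) (x i))"
        by (intro sum.cong refl)
          (simp add: elem_tensor_scale_right[OF x(1)] elem_tensor_scale_left[OF x(1)] f_restr_def e)
      finally show "elem_tensor scale E (e j) (\<phi> (f_restr j)) =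
          (\<Sum>i<n. elem_tensor scale E (scale (f j (e i)) (e j)) (x i))" .
    qed
    \<comment> \<open>The values \<open>f j (e i)\<close> need not form an identity matrix. After
      the sums are exchanged, the inner one is the coordinate expansion of
      \<open>e i\<close>.\<close>
    also have "\<dots> = (\<Sum>i<n. \<Sum>j<n. elem_tensor scale E (scale (f j (e i)) (e j)) (x i))"
      by (rule sum.swap)
    also have "\<dots> = (\<Sum>i<n. elem_tensor scale E (\<Sum>j<n. scale (f j (e i)) (e j)) (x i))"
      by (intro sum.cong refl elem_tensor_sum_left[symmetric] x(1)) simp
    also have "\<dots> = v"
      unfolding x(2) using coordinates[OF e] by (intro sum.cong refl) simp
    finally show ?thesis .
  qed
  have le: "lnorm E (amplification scale E \<phi> u) \<le> lnorm F u" if u: "u \<in> tensor_space scale UNIV F" for u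
  proof -
    obtain T where T: "T \<in> operators" "u = act scale F T incl_tensor"
      using tensor_is_operator[OF u] by blast
    \<comment> \<open>Amplifications commute with the action of operators on \<open>L\<close>, so
      the estimate reduces to the module inequality in \<open>E\<close> and the identity between
      \<open>onorm T\<close> and the norm of \<open>u\<close>.\<close>
    have "amplification scale E \<phi> u = act scale E T (amplification scale E \<phi> incl_tensor)"
      unfolding T(2) tensor_map_comp[OF linear_on_ident \<phi>]
        tensor_map_comp[OF operators_linear_on[OF T(1)] linear_maps_ident] ..
    then have "lnorm E (amplification scale E \<phi> u) \<le> onorm T * lnorm E v"
      using lnorm_act[OF E tensor_space_UNIV[OF v(1)] operators_bounded[OF T(1)]] by (simp add: amp)
    also have "\<dots> \<le> onorm T * 1"
      by (intro mult_left_mono v(2) onorm_pos_le operators_bounded_linear T(1))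
    also have "\<dots> = lnorm F u" using lnorm_act_incl_tensor[OF T(1)] by (simp add: T(2))
    finally show ?thesis .
  qed
  show thesis
  proof (rule that)
    show "restrict \<phi> (carr F) \<in> CC scale F E" by (rule restrict_in_CC[OF linear_F_nu \<phi> le])
    show "amplification scale E (restrict \<phi> (carr F)) incl_tensor = v"
      using amplification_restrict[OF linear_F_nu \<phi> incl_tensor_in] amp by simp
  qed
qed

text \<open>The singleton index set is a dummy that turns one tensor into a family, the form in
  which summands enter a direct sum.\<close>

lemma universal_tensors_F:
  assumes E: "is_lspace scale E"
  shows "universal_tensors scale F {a} (\<lambda>_. S) (\<lambda>_. incl_tensor) E"
  unfolding universal_tensors_def
proof (intro conjI ballI allI impI)
  fix v assume v: "\<forall>j\<in>{a}. v j \<in> tensor_space scale S E \<and> lnorm E (v j) \<le> 1"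
  then obtain \<phi> where "\<phi> \<in> CC scale F E" "amplification scale E \<phi> incl_tensor = v a"
    using CC_F_exists[OF E, of "v a"] by auto
  then show "\<exists>!\<phi>. \<phi> \<in> CC scale F E \<and> (\<forall>j\<in>{a}. amplification scale E \<phi> incl_tensor = v j)"
    using CC_F_eqI[OF is_lspace_linear[OF E]] by (intro ex1I[of _ \<phi>]) auto
qed (use incl_tensor_in lnorm_incl_tensor in auto)

end

section \<open>Assembly of the free spaces\<close>

lemma (in normed_space_over) complemented_subspace_exists:
  assumes "finite_dim scale S" "contractively_complemented scale S"
  obtains P n e f where "complemented_subspace scale S P n e f"
proof -
  obtain P where P: "P \<in> bounded_operators scale" "P \<circ> P = P" "onorm P \<le> 1" "range P = S"
    using assms(2) by (auto simp: contractively_complemented_def)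
  obtain B where B: "finite B" "span B = S" using assms(1) by (auto simp: finite_dim_def)
  obtain n :: nat and e f where "\<forall>i<n. e i \<in> span B \<and> f i \<in> dual_carr scale UNIV"
    "\<forall>x\<in>span B. x = (\<Sum>i<n. scale (f i x) (e i))"
    using finite_dim_coordinates[OF B(1)] by blast
  moreover have "P x = x" if "x \<in> S" for x
    using that P(2,4) by (metis comp_apply rangeE)
  ultimately have "complemented_subspace scale S P n e f"
    using P B(2) by unfold_locales auto
  then show thesis by (rule that)
qed

theorem proposition2p12:
  fixes sL :: "'k::real_or_complex \<Rightarrow> 'l::real_normed_vector \<Rightarrow> 'l"
    and \<Lambda> :: "'i set" and Lsub :: "'i \<Rightarrow> 'l set"
    and star :: 's and M :: "'t set"
  assumes "normed_space_over sL"
    and "\<forall>\<nu>\<in>\<Lambda>. module.subspace sL (Lsub \<nu>) \<and> finite_dim sL (Lsub \<nu>) \<and>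
              contractively_complemented sL (Lsub \<nu>)"
  shows "free_lspace sL (odot_obj sL \<Lambda> Lsub :: ('k, 'l, 'e::ab_group_add) lspace \<Rightarrow> _)
           (odot_mor sL \<Lambda>) {star} (F_star sL \<Lambda> Lsub)
       \<and> free_lspace sL (odot_obj sL \<Lambda> Lsub :: ('k, 'l, 'e) lspace \<Rightarrow> _)
           (odot_mor sL \<Lambda>) M (F_base sL \<Lambda> Lsub M)"
proof -
  interpret L: normed_space_over sL by (rule assms(1))
  let ?F = "\<lambda>\<nu>. F_nu sL (Lsub \<nu>)"
  let ?univ = "\<lambda>\<nu> w. is_lspace sL (?F \<nu>) \<and> (\<forall>E :: ('k, 'l, 'e) lspace. is_lspace sL E \<longrightarrow>
      universal_tensors sL (?F \<nu>) {star} (\<lambda>_. Lsub \<nu>) (\<lambda>_. w) E)"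
  have "\<forall>\<nu>\<in>\<Lambda>. \<exists>w. ?univ \<nu> w"
  proof
    fix \<nu> assume "\<nu> \<in> \<Lambda>"
    then have "finite_dim sL (Lsub \<nu>)" "contractively_complemented sL (Lsub \<nu>)"
      using assms(2) by auto
    then obtain P n e f where "complemented_subspace sL (Lsub \<nu>) P n e f"
      by (rule L.complemented_subspace_exists)
    then interpret complemented_subspace sL "Lsub \<nu>" P n e f .
    show "\<exists>w. ?univ \<nu> w"
      by (intro exI[of _ incl_tensor] conjI allI impI is_lspace_F universal_tensors_F)
  qed
  then obtain w where "\<forall>\<nu>\<in>\<Lambda>. ?univ \<nu> (w \<nu>)"
    by (rule bchoice[THEN exE])
  then have w: "\<And>\<nu>. \<nu> \<in> \<Lambda> \<Longrightarrow> is_lspace sL (?F \<nu>)"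
    "\<And>\<nu> E. \<nu> \<in> \<Lambda> \<Longrightarrow> is_lspace sL (E :: ('k, 'l, 'e) lspace) \<Longrightarrow>
      universal_tensors sL (?F \<nu>) {star} (\<lambda>_. Lsub \<nu>) (\<lambda>_. w \<nu>) E"
    by simp_all
  interpret N: lspace_family sL \<Lambda> ?F
  proof (rule lspace_family.intro)
    show "vector_space (scal (?F \<nu>))" for \<nu>
      using linear_F_nu[of sL "Lsub \<nu>"] by (simp add: linear_lspace_def)
  qed (rule w(1))
  have star_lspace: "is_lspace sL (F_star sL \<Lambda> Lsub)"
    unfolding F_star_def by (rule N.is_lspace_oplus1)
  define w1 where "w1 = (\<lambda>\<nu>. N.inc \<nu> (w \<nu>))"
  have star_univ: "universal_tensors sL (F_star sL \<Lambda> Lsub) \<Lambda> Lsub w1 E"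
    if "is_lspace sL E" for E :: "('k, 'l, 'e) lspace"
  proof -
    \<comment> \<open>The direct sum indexes its tensors by pairs with the dummy index
      \<open>star\<close>, which is dropped here.\<close>
    have "bij_betw (\<lambda>\<nu>. (\<nu>, star)) \<Lambda> (\<Lambda> \<times> {star})"
      by (auto simp: bij_betw_def inj_on_def)
    from universal_tensors_reindex[OF N.universal_tensors_oplus1[OF that w(2)[OF _ that]] this]
    show ?thesis by (simp add: F_star_def comp_def w1_def)
  qed
  interpret B: lspace_family sL M "\<lambda>t. F_star sL \<Lambda> Lsub"
    using star_lspace by (intro lspace_family.intro) (simp_all add: is_lspace_def)
  \<comment> \<open>Over the singleton base the required indices are the pairs
    \<open>(star, \<nu>)\<close>, so \<open>star\<close> is added back, now in its role as the base
    point.\<close>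
  have "bij_betw snd ({star} \<times> \<Lambda>) \<Lambda>"
    by (auto simp: bij_betw_def inj_on_def)
  from universal_tensors_reindex[OF star_univ this]
  have "free_lspace sL (odot_obj sL \<Lambda> Lsub :: ('k, 'l, 'e) lspace \<Rightarrow> _) (odot_mor sL \<Lambda>) {star}
      (F_star sL \<Lambda> Lsub)"
    by (intro free_lspace_universal[OF star_lspace, where w = "w1 \<circ> snd"])
      (simp add: comp_def case_prod_unfold)
  \<comment> \<open>The sum over copies yields tensors indexed by pairs from \<open>M\<close> and
    \<open>\<Lambda>\<close>, exactly the index set that freeness asks for.\<close>
  moreover have "free_lspace sL (odot_obj sL \<Lambda> Lsub :: ('k, 'l, 'e) lspace \<Rightarrow> _) (odot_mor sL \<Lambda>) M
      (F_base sL \<Lambda> Lsub M)"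
    unfolding F_base_def
    by (rule free_lspace_universal[OF B.is_lspace_oplus1 B.universal_tensors_oplus1[OF _ star_univ]])
  ultimately show ?thesis ..
qed

end
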